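(* Consider the Cauchy problem $$\frac{d}{dt}a_k(t)=e^{\mathrm{i}\theta}\left[-k^2\omega^2a_k(t)+(a(t)*a(t))_k\right]\quad(k\in\mathbb{Z}),\qquad a(0)=\varphi.$$ For the given initial sequence $a(0)=\varphi$ and its approximation $\bar a(0)$, assume there exists $\varepsilon\ge0$ such that $\|a(0)-\bar a(0)\|_{\ell^1}\le\varepsilon$. Let $\varrho>0$. Assume also that $\bar a\in C^1(J;D(L))$ and that any $a\in B_J(\bar a,\varrho)$ satisfies $$\sup_{t\in J}\sum_{k\in\mathbb{Z}}\left|\left[T(a)(t)-\bar a(t)\right]_k\right|\le f_\varepsilon(\varrho),$$ where $$f_\varepsilon(\varrho)=\boldsymbol{W_h}\left[\varepsilon+h\left(2\varrho^2+\delta\right)\right],$$ and $\boldsymbol{W_h}>0$ and $\delta>0$ satisfy $\sup_{0\le s\le t\le h}\|U(t,s)\|_{B(\ell^1)}\le\boldsymbol{W_h}$ and $\|F(\bar a)\|_X\le\delta$, respectively. If $$f_\varepsilon(\varrho)\le\varrho,$$ then the sequence $\tilde a$ of Fourier coefficients of the solution of $$u_t=e^{\mathrm{i}\theta}(u_{xx}+u^2),\quad x\in(0,1),$$ with periodic boundary conditions and initial Fourier coefficients $\varphi$ (equivalently, the solution $\tilde a$ on $J$ of the Cauchy problem $\frac{d}{dt}a_k(t)=e^{\mathrm{i}\theta}\left[-k^2\omega^2a_k(t)+(a(t)*a(t))_k\right]$ $(k\in\mathbb{Z})$, $a(0)=\varphi$) is contained in $B_J(\bar a,\varrho)$ and is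 unique in $B_J(\bar a,\varrho)$.
   Context: Fix $\theta\in(-\pi/2,\pi/2)$, $\omega=2\pi$, $h>0$ and $J=(0,h)$. Let $\ell^1$ be the Banach space of bi-infinite complex sequences $a=(a_k)_{k\in\mathbb{Z}}$ with $\|a\|_{\ell^1}=\sum_k|a_k|<\infty$. Discrete convolution is $(b*c)_k=\sum_{m\in\mathbb{Z}}b_{k-m}c_m$. $B(\ell^1)$ denotes the bounded linear operators on $\ell^1$ with operator norm. The space $X=C(J;\ell^1)$ carries the norm $\|a\|_X=\sup_{t\in J}\|a(t)\|_{\ell^1}$ (functions with prescribed value at $0$ are understood to be continuous up to $t=0$). The Laplacian is $Lb=(-k^2\omega^2b_k)_{k\in\mathbb{Z}}$ with domain $D(L)=\{a:\sum_k k^2|a_k|<\infty\}\subset\ell^1$. A function $u(t,x)=\sum_{k\in\mathbb{Z}}a_k(t)e^{\mathrm{i}k\omega x}$ solves the PDE iff its Fourier coefficients solve the Cauchy problem. The initial sequence $\varphi\in\ell^1$ is given. The approximate solution is $\bar a(t)=(\dots,0,0,\bar a_{-N}(t),\dots,\bar a_N(t),0,0,\dots)$, a finitely supported (in $k$) sequence depending on $t$. Define $$B_J(\bar a,\varrho)=\{a\in X:\ \|a-\bar a\|_X\le\varrho,\ a(0)=\varphi\},$$ $$(F(a))(t)=\frac{d}{dt}a(t)-e^{\mathrm{i}\theta}\left(La(t)+a(t)*a(t)\right)\quad\text{for }a\in C^1(J;D(L)).$$ $U(t,s)$, $0\le s\le t\le h$, is the evolution operator on $\ell^1$ of the linearized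 problem $$\frac{d}{dt}b_k(t)+e^{\mathrm{i}\theta}\left[k^2\omega^2b_k(t)-2(\bar a(t)*b(t))_k\right]=0\quad(k\in\mathbb{Z}),$$ i.e. $b(t)=U(t,s)\phi$ is its solution with $b(s)=\phi\in\ell^1$. The operator $T:X\to X$ is $$(T(a))(t)=U(t,0)\varphi+\int_0^tU(t,\tau)\,e^{\mathrm{i}\theta}\left(a(\tau)*a(\tau)-2\bar a(\tau)*a(\tau)\right)d\tau .$$ *)

theory Defs
  imports "HOL-Analysis.Analysis"
begin

no_notation Infinite_Set_Sum.abs_summable_on (infix \<open>abs'_summable'_on\<close> 50)

typedef ell1 = "{a :: int \<Rightarrow> complex. a abs_summable_on UNIV}"
  morphisms coef Abs_ell1
  by (rule exI[of _ "\<lambda>_. 0"]) simp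

setup_lifting type_definition_ell1

lemma coef_abs_summable: "(\<lambda>k. norm (coef a k)) summable_on UNIV"
  using coef[of a] by simp

lemma ell1_eqI: "(\<And>k. coef a k = coef b k) \<Longrightarrow> a = b"
  by (metis coef_inject ext)

instantiation ell1 :: real_vector
begin

lift_definition zero_ell1 :: ell1 is "\<lambda>_. 0" by simp

lift_definition plus_ell1 :: "ell1 \<Rightarrow> ell1 \<Rightarrow> ell1" is "\<lambda>a b k. a k + b k"
proof -
  fix a b :: "int \<Rightarrow> complex"
  assume "a abs_summable_on UNIV" "b abs_summable_on UNIV"
  then have "(\<lambda>k. norm (a k) + norm (b k)) summable_on UNIV"
    by (rule summable_on_add)
  then show "(\<lambda>k. a k + b k) abs_summable_on UNIV"
    by (rule Infinite_Sum.abs_summable_on_comparison_test') (simp add: norm_triangle_ineq)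
qed

lift_definition uminus_ell1 :: "ell1 \<Rightarrow> ell1" is "\<lambda>a k. - a k" by simp

definition minus_ell1 :: "ell1 \<Rightarrow> ell1 \<Rightarrow> ell1" where "a - b = a + (- b)" for a b :: ell1

lift_definition scaleR_ell1 :: "real \<Rightarrow> ell1 \<Rightarrow> ell1" is "\<lambda>r a k. r *\<^sub>R a k"
  unfolding norm_scaleR by (rule summable_on_cmult_right)

instance
proof
  fix a b c :: ell1 and r s :: real
  show "a + b + c = a + (b + c)" by transfer (simp add: add.assoc)
  show "a + b = b + a" by transfer (simp add: add.commute)
  show "0 + a = a" by transfer simp
  show "- a + a = 0" by transfer simp
  show "a - b = a + - b" by (rule minus_ell1_def)
  show "r *\<^sub>R (a + b) = r *\<^sub>R a + r *\<^sub>R b" by transfer (simp add: scaleR_add_right)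
  show "(r + s) *\<^sub>R a = r *\<^sub>R a + s *\<^sub>R a" by transfer (simp add: scaleR_add_left)
  show "r *\<^sub>R s *\<^sub>R a = (r * s) *\<^sub>R a" by transfer simp
  show "1 *\<^sub>R a = a" by transfer simp
qed

end

lemma coef_zero [simp]: "coef 0 k = 0" by transfer simp
lemma coef_add [simp]: "coef (a + b) k = coef a k + coef b k" by transfer simp
lemma coef_uminus [simp]: "coef (- a) k = - coef a k" by transfer simp
lemma coef_diff [simp]: "coef (a - b) k = coef a k - coef b k"
  by (simp only: minus_ell1_def coef_add coef_uminus diff_conv_add_uminus)
lemma coef_scaleR [simp]: "coef (r *\<^sub>R a) k = r *\<^sub>R coef a k" by transfer simp

instantiation ell1 :: real_normed_vector
begin

definition norm_ell1 :: "ell1 \<Rightarrow> real" where "norm a = (\<Sum>\<^sub>\<infinity>k. norm (coef a k))" for a :: ell1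

definition dist_ell1 :: "ell1 \<Rightarrow> ell1 \<Rightarrow> real" where "dist a b = norm (a - b)" for a b :: ell1

definition sgn_ell1 :: "ell1 \<Rightarrow> ell1" where "sgn a = a /\<^sub>R norm a" for a :: ell1

definition uniformity_ell1 :: "(ell1 \<times> ell1) filter"
  where "uniformity_ell1 = (INF e\<in>{0 <..}. principal {(x, y). dist x y < e})"

definition open_ell1 :: "ell1 set \<Rightarrow> bool"
  where "open_ell1 S = (\<forall>x\<in>S. \<forall>\<^sub>F (x', y) in uniformity. x' = x \<longrightarrow> y \<in> S)"

instance
proof
  fix a b :: ell1 and r :: real and S :: "ell1 set"
  show "dist a b = norm (a - b)" by (rule dist_ell1_def)
  show "sgn a = a /\<^sub>R norm a" by (rule sgn_ell1_def)
  show "uniformity = (INF e\<in>{0 <..}. principal {(x, y :: ell1). dist x y < e})"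
    by (rule uniformity_ell1_def)
  show "open S = (\<forall>x\<in>S. \<forall>\<^sub>F (x', y) in uniformity. x' = x \<longrightarrow> y \<in> S)"
    by (rule open_ell1_def)
  show "norm a = 0 \<longleftrightarrow> a = 0"
  proof
    assume n: "norm a = 0"
    have "norm (coef a k) \<le> norm a" for k
      using finite_sum_le_infsum[OF coef_abs_summable[of a], of "{k}"]
      by (simp add: norm_ell1_def)
    with n show "a = 0" by (intro ell1_eqI) simp
  qed (simp add: norm_ell1_def)
  show "norm (a + b) \<le> norm a + norm b"
  proof -
    have "norm (a + b) \<le> (\<Sum>\<^sub>\<infinity>k. norm (coef a k) + norm (coef b k))"
      unfolding norm_ell1_def
      by (rule infsum_mono[OF coef_abs_summable summable_on_add[OF coef_abs_summable coef_abs_summable]])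
        (simp add: norm_triangle_ineq)
    also have "\<dots> = norm a + norm b"
      unfolding norm_ell1_def by (rule infsum_add[OF coef_abs_summable coef_abs_summable])
    finally show ?thesis .
  qed
  show "norm (r *\<^sub>R a) = \<bar>r\<bar> * norm a"
    unfolding norm_ell1_def coef_scaleR norm_scaleR by (rule infsum_cmult_right')
qed

end

lemma norm_coef_le: "norm (coef a k) \<le> norm a"
  using finite_sum_le_infsum[OF coef_abs_summable[of a], of "{k}"]
  by (simp add: norm_ell1_def)

lemma sum_norm_coef_le: "finite F \<Longrightarrow> (\<Sum>k\<in>F. norm (coef a k)) \<le> norm a"
  unfolding norm_ell1_def by (rule finite_sum_le_infsum[OF coef_abs_summable]) auto

instance ell1 :: banach
proof
  fix X :: "nat \<Rightarrow> ell1"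
  assume X: "Cauchy X"
  have "Cauchy (\<lambda>n. coef (X n) k)" for k
  proof (rule metric_CauchyI)
    fix e :: real assume "e > 0"
    then obtain M where M: "\<And>m n. m \<ge> M \<Longrightarrow> n \<ge> M \<Longrightarrow> dist (X m) (X n) < e"
      using X unfolding Cauchy_def by metis
    have "dist (coef (X m) k) (coef (X n) k) \<le> dist (X m) (X n)" for m n
      using norm_coef_le[of "X m - X n" k] by (simp add: dist_norm)
    with M show "\<exists>M. \<forall>m\<ge>M. \<forall>n\<ge>M. dist (coef (X m) k) (coef (X n) k) < e"
      by (meson le_less_trans)
  qed
  then have "\<forall>k. \<exists>l. (\<lambda>n. coef (X n) k) \<longlonglongrightarrow> l"
    using convergent_eq_Cauchy by blast
  then obtain l where l: "\<And>k. (\<lambda>n. coef (X n) k) \<longlonglongrightarrow> l k" by metis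
  have bound: "(\<Sum>k\<in>F. norm (coef (X n) k - l k)) \<le> e"
    if "finite F" "\<And>m. m \<ge> M \<Longrightarrow> norm (X n - X m) \<le> e" for F M n e
  proof (rule Lim_bounded)
    show "(\<lambda>m. \<Sum>k\<in>F. norm (coef (X n) k - coef (X m) k))
        \<longlonglongrightarrow> (\<Sum>k\<in>F. norm (coef (X n) k - l k))"
      by (intro tendsto_intros l)
    show "\<forall>m\<ge>M. (\<Sum>k\<in>F. norm (coef (X n) k - coef (X m) k)) \<le> e"
      using sum_norm_coef_le[OF that(1)] that(2) unfolding coef_diff[symmetric]
      by (meson order_trans)
  qed
  have ev: "\<exists>M. \<forall>n\<ge>M. \<forall>F. finite F \<longrightarrow> (\<Sum>k\<in>F. norm (coef (X n) k - l k)) \<le> e"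
    if "e > 0" for e
  proof -
    from that obtain M where "\<And>m n. m \<ge> M \<Longrightarrow> n \<ge> M \<Longrightarrow> dist (X m) (X n) < e"
      using X unfolding Cauchy_def by metis
    then have "\<And>m n. m \<ge> M \<Longrightarrow> n \<ge> M \<Longrightarrow> norm (X n - X m) \<le> e"
      by (metis dist_norm less_imp_le)
    then show ?thesis using bound by blast
  qed
  obtain M where M: "\<And>F. finite F \<Longrightarrow> (\<Sum>k\<in>F. norm (coef (X M) k - l k)) \<le> 1"
    using ev[of 1] by auto
  have "(\<lambda>k. coef (X M) k - l k) abs_summable_on UNIV"
    by (rule nonneg_bdd_above_summable_on) (auto intro!: bdd_aboveI[of _ 1] M)
  then have "(\<lambda>k. norm (coef (X M) k) + norm (coef (X M) k - l k)) summable_on UNIV"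
    by (rule summable_on_add[OF coef_abs_summable])
  then have "l abs_summable_on UNIV"
    by (rule Infinite_Sum.abs_summable_on_comparison_test')
      (metis norm_minus_commute norm_triangle_sub)
  then have cl: "coef (Abs_ell1 l) = l" by (simp add: Abs_ell1_inverse)
  have "X \<longlonglongrightarrow> Abs_ell1 l"
  proof (rule metric_LIMSEQ_I)
    fix e :: real assume "e > 0"
    with ev[of "e/2"] obtain M
      where M: "\<And>n F. n \<ge> M \<Longrightarrow> finite F \<Longrightarrow> (\<Sum>k\<in>F. norm (coef (X n) k - l k)) \<le> e/2"
      by auto
    have "dist (X n) (Abs_ell1 l) < e" if "n \<ge> M" for n
    proof -
      have "(\<Sum>k\<in>F. norm (coef (X n - Abs_ell1 l) k)) \<le> e/2" if "finite F" for F
        using M[OF \<open>n \<ge> M\<close> that] by (simp only: coef_diff cl)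
      then have "norm (X n - Abs_ell1 l) \<le> e/2"
        unfolding norm_ell1_def by (rule infsum_le_finite_sums[OF coef_abs_summable])
      with \<open>e > 0\<close> show ?thesis by (simp add: dist_norm)
    qed
    then show "\<exists>no. \<forall>n\<ge>no. dist (X n) (Abs_ell1 l) < e" by blast
  qed
  then show "convergent X" by (rule convergentI)
qed

lift_definition cscale :: "complex \<Rightarrow> ell1 \<Rightarrow> ell1" (infixr "*\<^sub>C" 75) is "\<lambda>z a k. z * a k"
  unfolding norm_mult by (rule summable_on_cmult_right)

lemma coef_cscale [simp]: "coef (z *\<^sub>C a) k = z * coef a k" by transfer simp

lift_definition conv :: "ell1 \<Rightarrow> ell1 \<Rightarrow> ell1" (infixl "\<star>" 70)
  is "\<lambda>b c k. \<Sum>\<^sub>\<infinity>m. b (k - m) * c m"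
proof -
  fix b c :: "int \<Rightarrow> complex"
  assume b: "b abs_summable_on UNIV" and c: "c abs_summable_on UNIV"
  note Sigma_iff = Infinite_Sum.abs_summable_on_Sigma_iff[of _ UNIV "\<lambda>_. UNIV"]
  have "(\<lambda>m. norm (b i * c m)) summable_on UNIV" for i
    unfolding norm_mult using c by (rule summable_on_cmult_right)
  moreover have "(\<lambda>i. \<Sum>\<^sub>\<infinity>m. norm (b i * c m)) abs_summable_on UNIV"
    using summable_on_cmult_left[OF b, of "\<Sum>\<^sub>\<infinity>m. norm (c m)"]
    by (simp add: norm_mult infsum_cmult_right' abs_mult infsum_nonneg)
  ultimately have "(\<lambda>p. b (fst p) * c (snd p)) abs_summable_on UNIV \<times> UNIV"
    unfolding Sigma_iff by simp
  moreover have bij: "bij_betw (\<lambda>(k, m). (k - m, m)) (UNIV \<times> UNIV) (UNIV \<times> (UNIV :: int set))"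
    by (rule bij_betwI[where g = "\<lambda>(i, m). (i + m, m)"]) auto
  ultimately have "(\<lambda>p. b (fst p - snd p) * c (snd p)) abs_summable_on UNIV \<times> UNIV"
    using summable_on_reindex_bij_betw[OF bij, of "\<lambda>p. norm (b (fst p) * c (snd p))"]
    by (simp only: case_prod_unfold fst_conv snd_conv)
  then have i: "(\<lambda>m. b (k - m) * c m) abs_summable_on UNIV"
    and s: "(\<lambda>k. \<Sum>\<^sub>\<infinity>m. norm (b (k - m) * c m)) abs_summable_on UNIV" for k
    unfolding Sigma_iff by simp_all
  have "norm (\<Sum>\<^sub>\<infinity>m. b (k - m) * c m) \<le> norm (\<Sum>\<^sub>\<infinity>m. norm (b (k - m) * c m))" for k
    using norm_infsum_bound[OF i[of k]] by simp
  with s show "(\<lambda>k. \<Sum>\<^sub>\<infinity>m. b (k - m) * c m) abs_summable_on UNIV"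
    by (rule Infinite_Sum.abs_summable_on_comparison_test)
qed

lemma coef_conv: "coef (b \<star> c) k = (\<Sum>\<^sub>\<infinity>m. coef b (k - m) * coef c m)"
  by transfer simp

abbreviation omega :: real ("\<omega>") where "\<omega> \<equiv> 2 * pi"

definition dom_lap :: "ell1 set"
  where "dom_lap = {a. (\<lambda>k. (real_of_int k)\<^sup>2 * norm (coef a k)) summable_on UNIV}"

text \<open>Only meaningful on \<^const>\<open>dom_lap\<close>.\<close>
definition lap :: "ell1 \<Rightarrow> ell1"
  where "lap b = Abs_ell1 (\<lambda>k. of_real (- (real_of_int k)\<^sup>2 * \<omega>\<^sup>2) * coef b k)"

lemma coef_lap:
  assumes "b \<in> dom_lap"
  shows "coef (lap b) k = of_real (- (real_of_int k)\<^sup>2 * \<omega>\<^sup>2) * coef b k"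
proof -
  have "(\<lambda>k. \<omega>\<^sup>2 * ((real_of_int k)\<^sup>2 * norm (coef b k))) summable_on UNIV"
    using assms unfolding dom_lap_def by (intro summable_on_cmult_right) simp
  then have "(\<lambda>k. of_real (- (real_of_int k)\<^sup>2 * \<omega>\<^sup>2) * coef b k) abs_summable_on UNIV"
    by (rule Infinite_Sum.abs_summable_on_comparison_test')
      (simp add: norm_mult norm_power power_mult_distrib abs_mult mult_ac)
  then show ?thesis by (simp add: lap_def Abs_ell1_inverse)
qed

text \<open>The supremum over \<open>J = (0,h)\<close> is taken in the extended nonnegative reals, so that it is
  meaningful also for functions that are not known to be bounded.\<close>
definition sup_norm :: "real \<Rightarrow> (real \<Rightarrow> ell1) \<Rightarrow> ennreal"
  where "sup_norm h a = (SUP t\<in>{0<..<h}. ennreal (norm (a t)))"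

definition space_X :: "real \<Rightarrow> (real \<Rightarrow> ell1) set"
  where "space_X h = {a. continuous_on {0<..<h} a \<and> sup_norm h a < \<infinity>}"

text \<open>\<open>C\<^sup>1(J; D(L))\<close>, where \<open>D(L)\<close> carries the graph norm \<open>\<parallel>a\<parallel> + \<parallel>L a\<parallel>\<close>: differentiability and
  continuity in the graph norm amount to those of the function and of its image under \<open>L\<close>.\<close>
definition C1_dom_lap :: "real \<Rightarrow> (real \<Rightarrow> ell1) set"
  where "C1_dom_lap h = {a. \<exists>a'.
    (\<forall>t\<in>{0<..<h}. a t \<in> dom_lap \<and> a' t \<in> dom_lap \<and>
       (a has_vector_derivative a' t) (at t) \<and>
       ((\<lambda>s. lap (a s)) has_vector_derivative lap (a' t)) (at t)) \<and>
    continuous_on {0<..<h} a' \<and> continuous_on {0<..<h} (\<lambda>t. lap (a' t))}"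

text \<open>The value at \<open>0\<close> is attained continuously.\<close>
definition ball_J :: "real \<Rightarrow> ell1 \<Rightarrow> (real \<Rightarrow> ell1) \<Rightarrow> real \<Rightarrow> (real \<Rightarrow> ell1) set"
  where "ball_J h \<phi> abar \<rho> = {a \<in> space_X h. continuous_on {0..<h} a \<and>
     sup_norm h (\<lambda>t. a t - abar t) \<le> ennreal \<rho> \<and> a 0 = \<phi>}"

definition F_op :: "real \<Rightarrow> (real \<Rightarrow> ell1) \<Rightarrow> real \<Rightarrow> ell1"
  where "F_op \<theta> a t =
    vector_derivative a (at t) - cis \<theta> *\<^sub>C (lap (a t) + a t \<star> a t)"

text \<open>\<open>U t s \<phi>\<close> is defined by the linearized problem on \<open>(s, h)\<close>, understood coefficientwise, for
  functions that are \<open>ell1\<close>-continuous on \<open>[s, h]\<close>. The type \<open>ell1 \<Rightarrow>\<^sub>L ell1\<close> only records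
  real linearity; complex linearity of \<open>U t s\<close> is a consequence of unique solvability, and the
  operator norm is the same.\<close>
definition evolution_operator ::
    "real \<Rightarrow> real \<Rightarrow> (real \<Rightarrow> ell1) \<Rightarrow> (real \<Rightarrow> real \<Rightarrow> ell1 \<Rightarrow>\<^sub>L ell1) \<Rightarrow> bool"
  where "evolution_operator \<theta> h abar U \<longleftrightarrow>
    (\<forall>s\<in>{0..h}. \<forall>\<phi>.
       U s s \<phi> = \<phi> \<and>
       continuous_on {s..h} (\<lambda>t. U t s \<phi>) \<and>
       (\<forall>t\<in>{s<..<h}. \<forall>k. \<exists>d.
          ((\<lambda>r. coef (U r s \<phi>) k) has_vector_derivative d) (at t) \<and>
          d + cis \<theta> * (of_real ((real_of_int k)\<^sup>2 * \<omega>\<^sup>2) * coef (U t s \<phi>) k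
                        - 2 * coef (abar t \<star> U t s \<phi>) k) = 0))"

definition T_op ::
    "real \<Rightarrow> ell1 \<Rightarrow> (real \<Rightarrow> ell1) \<Rightarrow> (real \<Rightarrow> real \<Rightarrow> ell1 \<Rightarrow>\<^sub>L ell1) \<Rightarrow>
     (real \<Rightarrow> ell1) \<Rightarrow> real \<Rightarrow> ell1"
  where "T_op \<theta> \<phi> abar U a t = U t 0 \<phi> +
    integral {0..t} (\<lambda>\<tau>. U t \<tau> (cis \<theta> *\<^sub>C (a \<tau> \<star> a \<tau> - 2 *\<^sub>R (abar \<tau> \<star> a \<tau>))))"

definition f_bound :: "real \<Rightarrow> real \<Rightarrow> real \<Rightarrow> real \<Rightarrow> real \<Rightarrow> real"
  where "f_bound W h \<delta> \<epsilon> \<rho> = W * (\<epsilon> + h * (2 * \<rho>\<^sup>2 + \<delta>))"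

definition cauchy_solution :: "real \<Rightarrow> real \<Rightarrow> ell1 \<Rightarrow> (real \<Rightarrow> ell1) \<Rightarrow> bool"
  where "cauchy_solution \<theta> h \<phi> a \<longleftrightarrow>
    continuous_on {0..<h} a \<and> a 0 = \<phi> \<and>
    (\<forall>t\<in>{0<..<h}. \<forall>k. ((\<lambda>s. coef (a s) k) has_vector_derivative
        cis \<theta> * (- of_real ((real_of_int k)\<^sup>2 * \<omega>\<^sup>2) * coef (a t) k + coef (a t \<star> a t) k)) (at t))"

definition fourier_series :: "ell1 \<Rightarrow> real \<Rightarrow> complex"
  where "fourier_series a x = (\<Sum>\<^sub>\<infinity>k. coef a k * cis (real_of_int k * \<omega> * x))"

text \<open>Classical solutions, with one-sided spatial derivatives at the end points of \<open>[0,1]\<close>;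
  the last conjunct says that the initial function has the Fourier coefficients \<open>\<phi>\<close>.\<close>
definition periodic_pde_solution :: "real \<Rightarrow> real \<Rightarrow> ell1 \<Rightarrow> (real \<Rightarrow> real \<Rightarrow> complex) \<Rightarrow> bool"
  where "periodic_pde_solution \<theta> h \<phi> u \<longleftrightarrow>
    continuous_on ({0..<h} \<times> {0..1}) (\<lambda>(t, x). u t x) \<and>
    (\<exists>ut ux uxx.
      (\<forall>t\<in>{0<..<h}. \<forall>x\<in>{0..1}.
        ((\<lambda>s. u s x) has_vector_derivative ut t x) (at t) \<and>
        (u t has_vector_derivative ux t x) (at x within {0..1}) \<and>
        (ux t has_vector_derivative uxx t x) (at x within {0..1})) \<and>
      continuous_on ({0<..<h} \<times> {0..1}) (\<lambda>(t, x). ut t x) \<and>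
      continuous_on ({0<..<h} \<times> {0..1}) (\<lambda>(t, x). uxx t x) \<and>
      (\<forall>t\<in>{0<..<h}. \<forall>x\<in>{0<..<1}. ut t x = cis \<theta> * (uxx t x + (u t x)\<^sup>2)) \<and>
      (\<forall>t\<in>{0<..<h}. u t 0 = u t 1 \<and> ux t 0 = ux t 1)) \<and>
    (\<forall>k. integral {0..1} (\<lambda>x. u 0 x * cis (- (real_of_int k * \<omega> * x))) = coef \<phi> k)"

end

theory Submission
  imports Defs
begin

text \<open>
  The deviation \<open>w = a - abar\<close> of a solution \<open>a\<close> from the approximate solution satisfies the
  linearized problem with the additional terms \<open>e\<^bsup>i\<theta>\<^esup> w \<star> w\<close> and \<open>-F(abar)\<close>. As long as
  \<open>\<parallel>w\<parallel> \<le> \<rho>\<close>, these have norm at most \<open>\<rho>\<^sup>2 + \<delta>\<close>, and the bound \<open>W\<close> of the evolution operator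
  yields \<open>\<parallel>w(t)\<parallel> \<le> W (\<epsilon> + h (\<rho>\<^sup>2 + \<delta>)) \<le> f\<^sub>\<epsilon>(\<rho>) \<le> \<rho>\<close>, so the solution is confined to the ball.
  To make this a proof of existence, the square \<open>w \<star> w\<close> is cut off outside the ball
  (\<open>cauchy_solution_enclosure\<close>). The modified problem has a globally Lipschitz coupling and is
  solvable up to time \<open>h\<close> by Picard iteration (\<open>diag_lipschitz_solvable\<close>), and the estimate shows
  that the cut-off never acts.

  The analysis is done mode by mode. Every equation that occurs has the form
  \<open>z\<^sub>k' = -m\<^sub>k z\<^sub>k + g\<^sub>k\<close> with \<open>Re m\<^sub>k \<ge> 0\<close>, for which \<open>\<parallel>z\<parallel>\<close> grows at most at the rate \<open>\<parallel>g\<parallel>\<close>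
  (\<open>diag_solution_bound\<close>). This single inequality gives uniqueness, the continuity of solutions in
  norm, the contraction for Picard iteration, and, with \<open>m\<^sub>k\<close> lowered by a multiple of \<open>\<bar>k\<bar>\<close>, the
  smoothing effect. The evolution operator enters through its defining coefficient equations: a
  perturbed solution is compared with the evolution on a fine partition of the time interval
  (\<open>evolution_operator_perturbation\<close>).

  For the partial differential equation, diffusion compensates a weight \<open>e\<^bsup>ct\<bar>k\<bar>\<^esup>\<close>, so for positive
  times the coefficients decay exponentially, locally uniformly in time
  (\<open>cauchy_solution_exp_decay\<close>), and the Fourier series is a classical solution
  (\<open>cauchy_solution_imp_pde\<close>). Conversely the Fourier coefficients of a classical solution solve the
  Cauchy problem (\<open>pde_imp_cauchy_solution\<close>). So uniqueness for both notions of solution follows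
  from uniqueness for the coefficient equations among bounded curves (\<open>cauchy_solution_unique\<close>).
\<close>

section \<open>Elementary facts about absolutely summable sequences\<close>

lemma coef_sum [simp]: "coef (\<Sum>i\<in>I. f i) k = (\<Sum>i\<in>I. coef (f i) k)"
  by (induction I rule: infinite_finite_induct) auto

lemma norm_le_finite_sums:
  assumes "\<And>F. finite F \<Longrightarrow> (\<Sum>k\<in>F. norm (coef a k)) \<le> B"
  shows "norm a \<le> B"
  unfolding norm_ell1_def by (rule infsum_le_finite_sums[OF coef_abs_summable]) (use assms in auto)

lemma norm_ell1_mono:
  assumes "\<And>k. norm (coef a k) \<le> norm (coef b k)"
  shows "norm a \<le> norm b"
  unfolding norm_ell1_def by (rule infsum_mono[OF coef_abs_summable coef_abs_summable assms])

lemma coef_Abs_ell1: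
  assumes "f abs_summable_on UNIV"
  shows "coef (Abs_ell1 f) = f"
  using assms by (simp add: Abs_ell1_inverse)

lemma abs_summableI:
  assumes "\<And>F. finite F \<Longrightarrow> (\<Sum>k\<in>F. norm (f k)) \<le> B"
  shows "f abs_summable_on UNIV"
  by (rule nonneg_bdd_above_summable_on) (auto intro!: bdd_aboveI[of _ B] assms)

definition mode :: "int \<Rightarrow> complex \<Rightarrow> ell1"
  where "mode k z = Abs_ell1 (\<lambda>j. if j = k then z else 0)"

lemma coef_mode [simp]: "coef (mode k z) j = (if j = k then z else 0)"
proof -
  have "(\<Sum>j\<in>F. norm (if j = k then z else 0)) \<le> norm z" if "finite F" for F
    using that by (simp add: if_distrib[of norm] cong: if_cong)
  then have "(\<lambda>j. if j = k then z else 0) abs_summable_on UNIV" by (rule abs_summableI)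
  then show ?thesis by (simp add: mode_def coef_Abs_ell1)
qed

lemma norm_sum_mode:
  assumes "finite F"
  shows "norm (\<Sum>k\<in>F. mode k (z k)) = (\<Sum>k\<in>F. norm (z k))"
proof -
  have "coef (\<Sum>k\<in>F. mode k (z k)) j = (if j \<in> F then z j else 0)" for j
    using assms by simp
  then have "norm (\<Sum>k\<in>F. mode k (z k)) = (\<Sum>\<^sub>\<infinity>j\<in>F. norm (z j))"
    unfolding norm_ell1_def by (subst infsum_cong_neutral[where T = F]) auto
  then show ?thesis using assms by simp
qed

lemma norm_mode [simp]: "norm (mode k z) = norm z"
  using norm_sum_mode[of "{k}" "\<lambda>_. z"] by simp

lemma bounded_linear_coef: "bounded_linear (\<lambda>a. coef a k)"
  by (rule bounded_linear_intro[where K = 1]) (auto simp: norm_coef_le)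

lemma bounded_linear_mode: "bounded_linear (mode k)"
  by (rule bounded_linear_intro[where K = 1]) (auto intro!: ell1_eqI)

lemma norm_cscale [simp]: "norm (z *\<^sub>C a) = norm z * norm a"
  unfolding norm_ell1_def coef_cscale norm_mult by (rule infsum_cmult_right')

lemma bounded_linear_cscale: "bounded_linear (\<lambda>a. z *\<^sub>C a)"
  by (rule bounded_linear_intro[where K = "norm z"]) (auto intro!: ell1_eqI simp: algebra_simps)

lemmas continuous_on_coef [continuous_intros] = bounded_linear.continuous_on[OF bounded_linear_coef]
lemmas continuous_on_mode [continuous_intros] = bounded_linear.continuous_on[OF bounded_linear_mode]
lemmas continuous_on_cscale [continuous_intros] = bounded_linear.continuous_on[OF bounded_linear_cscale]

subsection \<open>Finite truncations\<close>

definition cut :: "int set \<Rightarrow> ell1 \<Rightarrow> ell1"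
  where "cut F a = (\<Sum>k\<in>F. mode k (coef a k))"

lemma coef_cut: "finite F \<Longrightarrow> coef (cut F a) k = (if k \<in> F then coef a k else 0)"
  by (simp add: cut_def)

lemma norm_cut: "finite F \<Longrightarrow> norm (cut F a) = (\<Sum>k\<in>F. norm (coef a k))"
  by (simp add: cut_def norm_sum_mode)

lemma bounded_linear_cut: "bounded_linear (cut F)"
  unfolding cut_def
  by (intro bounded_linear_sum bounded_linear_compose[OF bounded_linear_mode bounded_linear_coef])

lemma norm_diff_cut_le: "finite F \<Longrightarrow> norm (a - cut F a) \<le> norm a"
  by (rule norm_ell1_mono) (simp add: coef_cut)

lemma norm_le_cut:
  assumes "\<And>F. finite F \<Longrightarrow> norm (cut F a) \<le> B"
  shows "norm a \<le> B"
  using assms by (intro norm_le_finite_sums) (simp add: norm_cut)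

lemma tendsto_cut: "((\<lambda>F. cut F a) \<longlongrightarrow> a) (finite_subsets_at_top UNIV)"
proof -
  have tail: "norm (a - cut F a) \<le> norm a - (\<Sum>k\<in>F. norm (coef a k))" if F: "finite F" for F
  proof (rule norm_le_finite_sums)
    fix G :: "int set" assume G: "finite G"
    have "(\<Sum>k\<in>G. norm (coef (a - cut F a) k)) = (\<Sum>k\<in>G - F. norm (coef a k))"
      using F G by (intro sum.mono_neutral_cong_right) (auto simp: coef_cut)
    also have "\<dots> = (\<Sum>k\<in>G \<union> F. norm (coef a k)) - (\<Sum>k\<in>F. norm (coef a k))"
    proof -
      have "(\<Sum>k\<in>(G - F) \<union> F. norm (coef a k)) = (\<Sum>k\<in>G - F. norm (coef a k)) + (\<Sum>k\<in>F. norm (coef a k))"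
        using F G by (intro sum.union_disjoint) auto
      then show ?thesis by simp
    qed
    finally show "(\<Sum>k\<in>G. norm (coef (a - cut F a) k)) \<le> norm a - (\<Sum>k\<in>F. norm (coef a k))"
      using sum_norm_coef_le[of "G \<union> F" a] F G by simp
  qed
  have "((\<lambda>F. \<Sum>k\<in>F. norm (coef a k)) \<longlongrightarrow> norm a) (finite_subsets_at_top UNIV)"
    unfolding norm_ell1_def by (rule infsum_tendsto[OF coef_abs_summable])
  then have "((\<lambda>F. norm a - (\<Sum>k\<in>F. norm (coef a k))) \<longlongrightarrow> 0) (finite_subsets_at_top UNIV)"
    using tendsto_diff[OF tendsto_const[of "norm a"]] by fastforce
  then have "((\<lambda>F. a - cut F a) \<longlongrightarrow> 0) (finite_subsets_at_top UNIV)"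
    by (rule Lim_null_comparison[rotated])
       (use tail in \<open>auto intro!: eventually_finite_subsets_at_top_weakI\<close>)
  from tendsto_diff[OF tendsto_const[of a] this] show ?thesis by simp
qed

lemma continuous_on_uniform_cut:
  fixes f :: "'a::topological_space \<Rightarrow> ell1"
  assumes "\<And>k. continuous_on S (\<lambda>t. coef (f t) k)"
    and "uniform_limit S (\<lambda>F t. cut F (f t)) f (finite_subsets_at_top UNIV)"
  shows "continuous_on S f"
proof (rule uniform_limit_theorem[OF _ assms(2)])
  show "\<forall>\<^sub>F F in finite_subsets_at_top UNIV. continuous_on S (\<lambda>t. cut F (f t))"
    unfolding cut_def
    by (intro always_eventually allI continuous_on_sum continuous_on_mode assms(1))
qed simp

text \<open>A summable majorant bounds the tails of all \<open>f t\<close> at once, so the truncations, which are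
  continuous in \<open>t\<close>, converge uniformly.\<close>

lemma continuous_on_dominated:
  fixes f :: "'a::topological_space \<Rightarrow> ell1"
  assumes "\<And>k. continuous_on S (\<lambda>t. coef (f t) k)"
    and M: "M summable_on UNIV" and le: "\<And>t k. t \<in> S \<Longrightarrow> norm (coef (f t) k) \<le> M k"
  shows "continuous_on S f"
proof (rule continuous_on_uniform_cut[OF assms(1)])
  define m where "m = Abs_ell1 (\<lambda>k. of_real \<bar>M k\<bar>)"
  have "(\<lambda>k. complex_of_real \<bar>M k\<bar>) abs_summable_on UNIV"
    using summable_on_iff_abs_summable_on_real[THEN iffD1, OF M] by simp
  then have m: "coef m k = of_real \<bar>M k\<bar>" for k
    by (simp add: m_def coef_Abs_ell1)
  show "uniform_limit S (\<lambda>F t. cut F (f t)) f (finite_subsets_at_top UNIV)"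
  proof (rule uniform_limitI)
    fix e :: real assume "e > 0"
    then have "\<forall>\<^sub>F F in finite_subsets_at_top UNIV. dist (cut F m) m < e"
      using tendsto_cut[of m] by (rule tendstoD[rotated])
    moreover have "\<forall>\<^sub>F F :: int set in finite_subsets_at_top UNIV. finite F"
      by (auto intro!: eventually_finite_subsets_at_top_weakI)
    ultimately show "\<forall>\<^sub>F F in finite_subsets_at_top UNIV. \<forall>t\<in>S. dist (cut F (f t)) (f t) < e"
    proof eventually_elim
      case (elim F)
      have "norm (f t - cut F (f t)) \<le> norm (m - cut F m)" if "t \<in> S" for t
        using elim(2) le[OF that] abs_ge_self[of "M _"]
        by (intro norm_ell1_mono) (auto simp: coef_cut m intro: order_trans)
      then show ?case using elim(1) by (auto simp: dist_norm norm_minus_commute intro: le_less_trans)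
    qed
  qed
qed

text \<open>On a compact set of sequences the tails are uniformly small, because the truncations are
  contractions converging at each point of a finite net.\<close>

lemma uniform_limit_cut_compact:
  fixes g :: "'a::topological_space \<Rightarrow> ell1"
  assumes "compact S" "continuous_on S g"
  shows "uniform_limit S (\<lambda>F t. cut F (g t)) g (finite_subsets_at_top UNIV)"
proof (rule uniform_limitI)
  fix e :: real assume "e > 0"
  have "compact (g ` S)" using assms by (rule compact_continuous_image[rotated])
  then obtain T where T: "finite T" "g ` S \<subseteq> (\<Union>y\<in>T. ball y (e/2))"
    using \<open>e > 0\<close> seq_compact_imp_totally_bounded[OF compact_imp_seq_compact, of "g ` S"]
    by (meson half_gt_zero)
  have "\<forall>\<^sub>F F in finite_subsets_at_top UNIV. \<forall>y\<in>T. dist (cut F y) y < e/2"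
    using T(1) \<open>e > 0\<close> by (intro eventually_ball_finite ballI tendstoD[OF tendsto_cut]) simp_all
  moreover have "\<forall>\<^sub>F F :: int set in finite_subsets_at_top UNIV. finite F"
    by (auto intro!: eventually_finite_subsets_at_top_weakI)
  ultimately show "\<forall>\<^sub>F F in finite_subsets_at_top UNIV. \<forall>t\<in>S. dist (cut F (g t)) (g t) < e"
  proof eventually_elim
    case (elim F)
    show ?case
    proof
      fix t assume "t \<in> S"
      then obtain y where y: "y \<in> T" "norm (g t - y) < e/2"
        using T(2) by (auto simp: dist_norm norm_minus_commute)
      have "g t - cut F (g t) = ((g t - y) - cut F (g t - y)) + (y - cut F y)"
        using linear_diff[OF bounded_linear.linear[OF bounded_linear_cut]] by simp
      then have "norm (g t - cut F (g t)) \<le> norm ((g t - y) - cut F (g t - y)) + norm (y - cut F y)"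
        by (metis norm_triangle_ineq)
      also have "\<dots> < e"
        using norm_diff_cut_le[OF elim(2), of "g t - y"] y elim(1)
        by (auto simp: dist_norm norm_minus_commute)
      finally show "dist (cut F (g t)) (g t) < e" by (simp add: dist_norm norm_minus_commute)
    qed
  qed
qed

subsection \<open>The convolution algebra\<close>

text \<open>Convolution sums the array \<open>x\<^sub>i y\<^sub>m\<close> along the lines \<open>i + m = k\<close>.\<close>

lemma conv_array:
  fixes x y :: ell1
  shows "(\<lambda>(k, m). coef x (k - m) * coef y m) abs_summable_on UNIV \<times> UNIV"
    and "(\<Sum>\<^sub>\<infinity>(k, m). norm (coef x (k - m) * coef y m)) = norm x * norm y"
    and "(\<Sum>\<^sub>\<infinity>(k, m). coef x (k - m) * coef y m) = (\<Sum>\<^sub>\<infinity>k. coef x k) * (\<Sum>\<^sub>\<infinity>k. coef y k)"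
proof -
  have bij: "bij_betw (\<lambda>(k, m). (k - m, m)) (UNIV \<times> UNIV) (UNIV \<times> (UNIV :: int set))"
    by (rule bij_betwI[where g = "\<lambda>(i, m). (i + m, m)"]) auto
  have s: "(\<lambda>(i, m). coef x i * coef y m) abs_summable_on UNIV \<times> UNIV"
    unfolding Infinite_Sum.abs_summable_on_Sigma_iff[of _ UNIV "\<lambda>_. UNIV"]
    using coef_abs_summable[of x] coef_abs_summable[of y]
    by (simp add: norm_mult infsum_cmult_right' summable_on_cmult_right summable_on_cmult_left abs_mult infsum_nonneg)
  show "(\<lambda>(k, m). coef x (k - m) * coef y m) abs_summable_on UNIV \<times> UNIV"
    using s summable_on_reindex_bij_betw[OF bij, of "\<lambda>p. norm (coef x (fst p) * coef y (snd p))"]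
    by (simp add: case_prod_unfold)
  have "(\<Sum>\<^sub>\<infinity>(k, m). norm (coef x (k - m) * coef y m)) = (\<Sum>\<^sub>\<infinity>(i, m). norm (coef x i * coef y m))"
    using infsum_reindex_bij_betw[OF bij, of "\<lambda>p. norm (coef x (fst p) * coef y (snd p))"]
    by (simp add: case_prod_unfold)
  also have "\<dots> = (\<Sum>\<^sub>\<infinity>i. \<Sum>\<^sub>\<infinity>m. norm (coef x i * coef y m))"
    using infsum_Sigma'_banach[of "\<lambda>i m. norm (coef x i * coef y m)" UNIV "\<lambda>_. UNIV"] s
    by (simp add: case_prod_unfold)
  also have "\<dots> = norm x * norm y"
    by (simp add: norm_ell1_def norm_mult infsum_cmult_right' infsum_cmult_left')
  finally show "(\<Sum>\<^sub>\<infinity>(k, m). norm (coef x (k - m) * coef y m)) = norm x * norm y" .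
  have "(\<Sum>\<^sub>\<infinity>(k, m). coef x (k - m) * coef y m) = (\<Sum>\<^sub>\<infinity>(i, m). coef x i * coef y m)"
    using infsum_reindex_bij_betw[OF bij, of "\<lambda>p. coef x (fst p) * coef y (snd p)"]
    by (simp add: case_prod_unfold)
  also have "\<dots> = (\<Sum>\<^sub>\<infinity>i. \<Sum>\<^sub>\<infinity>m. coef x i * coef y m)"
    using infsum_Sigma'_banach[of "\<lambda>i m. coef x i * coef y m" UNIV "\<lambda>_. UNIV"] abs_summable_summable[OF s]
    by (simp add: case_prod_unfold)
  also have "\<dots> = (\<Sum>\<^sub>\<infinity>k. coef x k) * (\<Sum>\<^sub>\<infinity>k. coef y k)"
    by (simp add: infsum_cmult_right' infsum_cmult_left')
  finally show "(\<Sum>\<^sub>\<infinity>(k, m). coef x (k - m) * coef y m) = (\<Sum>\<^sub>\<infinity>k. coef x k) * (\<Sum>\<^sub>\<infinity>k. coef y k)" .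
qed

lemma conv_row_summable:
  "(\<lambda>m. coef x (k - m) * coef y m) abs_summable_on UNIV"
  using conv_array(1)[of x y]
  unfolding case_prod_unfold Infinite_Sum.abs_summable_on_Sigma_iff[of _ UNIV "\<lambda>_. UNIV"] by simp

text \<open>The convolution of the absolute values has norm \<open>\<parallel>x\<parallel> \<parallel>y\<parallel>\<close>. Besides the algebra inequality this
  gives its weighted version, where \<open>c\<close> is not itself a convolution of \<open>x\<close> and \<open>y\<close>.\<close>

lemma norm_le_conv:
  assumes "\<And>k. norm (coef c k) \<le> (\<Sum>\<^sub>\<infinity>m. norm (coef x (k - m) * coef y m))"
  shows "norm c \<le> norm x * norm y"
proof -
  have s: "(\<lambda>(k, m). norm (coef x (k - m) * coef y m)) summable_on UNIV \<times> UNIV"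
    using conv_array(1)[of x y] by (simp add: case_prod_unfold)
  then have "(\<lambda>k. \<Sum>\<^sub>\<infinity>m. norm (coef x (k - m) * coef y m)) summable_on UNIV"
    using summable_on_Sigma_banach[of "\<lambda>k m. norm (coef x (k - m) * coef y m)" UNIV "\<lambda>_. UNIV"]
    by simp
  then have "norm c \<le> (\<Sum>\<^sub>\<infinity>k. \<Sum>\<^sub>\<infinity>m. norm (coef x (k - m) * coef y m))"
    unfolding norm_ell1_def by (rule infsum_mono[OF coef_abs_summable _ assms])
  also have "\<dots> = norm x * norm y"
    using infsum_Sigma'_banach[of "\<lambda>k m. norm (coef x (k - m) * coef y m)" UNIV "\<lambda>_. UNIV"] s
    by (simp add: conv_array(2))
  finally show ?thesis .
qed

lemma norm_conv_le: "norm (x \<star> y) \<le> norm x * norm y"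
  by (rule norm_le_conv) (simp add: coef_conv norm_infsum_bound[OF conv_row_summable])

lemma conv_commute: "x \<star> y = y \<star> x"
proof (rule ell1_eqI)
  fix k :: int
  have bij: "bij_betw (\<lambda>m. k - m) UNIV (UNIV :: int set)"
    by (rule bij_betwI[where g = "\<lambda>m. k - m"]) auto
  show "coef (x \<star> y) k = coef (y \<star> x) k"
    using infsum_reindex_bij_betw[OF bij, of "\<lambda>m. coef y (k - m) * coef x m"]
    by (simp add: coef_conv mult.commute)
qed

lemma bounded_bilinear_conv: "bounded_bilinear (\<star>)"
proof
  note summ = abs_summable_summable[OF conv_row_summable]
  show "(a + a') \<star> b = a \<star> b + a' \<star> b" for a a' b
    by (rule ell1_eqI) (simp add: coef_conv distrib_right infsum_add[OF summ summ])
  show "a \<star> (b + b') = a \<star> b + a \<star> b'" for a b b'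
    by (rule ell1_eqI) (simp add: coef_conv distrib_left infsum_add[OF summ summ])
  show "(r *\<^sub>R a) \<star> b = r *\<^sub>R (a \<star> b)" for r a b
    by (rule ell1_eqI) (simp add: coef_conv infsum_scaleR_right)
  show "a \<star> (r *\<^sub>R b) = r *\<^sub>R (a \<star> b)" for r a b
    by (rule ell1_eqI) (simp add: coef_conv infsum_scaleR_right)
  show "\<exists>K. \<forall>a b. norm (a \<star> b) \<le> norm a * norm b * K"
    by (intro exI[of _ 1]) (simp add: norm_conv_le)
qed

lemmas continuous_on_conv [continuous_intros] = bounded_bilinear.continuous_on[OF bounded_bilinear_conv]

lemma conv_diff_right: "a \<star> (b - c) = a \<star> b - a \<star> c"
  by (rule bounded_bilinear.diff_right[OF bounded_bilinear_conv])

lemma conv_diff_left: "(a - b) \<star> c = a \<star> c - b \<star> c"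
  by (rule bounded_bilinear.diff_left[OF bounded_bilinear_conv])

lemma conv_square_diff: "a \<star> a - b \<star> b = (a + b) \<star> (a - b)"
  by (simp add: bounded_bilinear.diff_right[OF bounded_bilinear_conv]
      bounded_bilinear.add_left[OF bounded_bilinear_conv] conv_commute[of b a])

subsection \<open>Differentiability from coefficients\<close>

text \<open>The mean value inequality bounds every finite truncation of \<open>f s - f t - (s - t) d t\<close> by the
  oscillation of \<open>d\<close> in the full norm, a bound that does not depend on the truncation. This is how
  coefficientwise equations are upgraded to differentiability in norm.\<close>

lemma has_vector_derivative_ell1I:
  fixes f d :: "real \<Rightarrow> ell1"
  assumes der: "\<And>s k. s \<in> {a<..<b} \<Longrightarrow> ((\<lambda>r. coef (f r) k) has_vector_derivative coef (d s) k) (at s)"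
    and cont: "continuous_on {a<..<b} d" and t: "t \<in> {a<..<b}"
  shows "(f has_vector_derivative d t) (at t)"
  unfolding has_vector_derivative_def has_derivative_at_alt
proof (intro conjI allI impI)
  show "bounded_linear (\<lambda>x. x *\<^sub>R d t)" by (rule bounded_linear_scaleR_left)
  fix e :: real assume "e > 0"
  have "isCont d t"
    using cont t by (simp add: continuous_on_eq_continuous_at)
  then obtain \<eta>1 where \<eta>1: "\<eta>1 > 0" "\<And>s. dist s t < \<eta>1 \<Longrightarrow> dist (d s) (d t) < e"
    using \<open>e > 0\<close> unfolding continuous_at_eps_delta by blast
  obtain \<eta>2 where \<eta>2: "\<eta>2 > 0" "ball t \<eta>2 \<subseteq> {a<..<b}"
    using t open_contains_ball[of "{a<..<b}"] open_greaterThanLessThan[of a b] by meson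
  define \<eta> where "\<eta> = min \<eta>1 \<eta>2"
  have "norm (f s - f t - (s - t) *\<^sub>R d t) \<le> e * norm (s - t)" if s: "norm (s - t) < \<eta>" for s
  proof (rule norm_le_cut)
    fix F :: "int set" assume F: "finite F"
    have dist: "dist r t < \<eta>" if "r \<in> closed_segment t s" for r
      using that s by (auto simp: dist_norm closed_segment_eq_real_ivl split: if_splits)
    have deriv: "((\<lambda>r. cut F (f r)) has_vector_derivative cut F (d r)) (at r within closed_segment t s)"
      if r: "r \<in> closed_segment t s" for r
    proof -
      have "r \<in> {a<..<b}"
        using dist[OF r] \<eta>2(2) by (auto simp: \<eta>_def subset_iff dist_commute)
      then have "((\<lambda>r. cut F (f r)) has_vector_derivative cut F (d r)) (at r)"
        unfolding cut_def
        by (intro has_vector_derivative_sum bounded_linear.has_vector_derivative[OF bounded_linear_mode] der)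
      then show ?thesis by (rule has_vector_derivative_at_within)
    qed
    note lin = linear_diff[OF bounded_linear.linear[OF bounded_linear_cut]]
      linear_scale[OF bounded_linear.linear[OF bounded_linear_cut]]
    have "norm (cut F (f s) - cut F (f t) - (s - t) *\<^sub>R cut F (d t)) \<le> norm (s - t) * e"
    proof (rule vector_differentiable_bound_linearization[OF deriv])
      fix r assume r: "r \<in> closed_segment t s"
      have "norm (cut F (d r - d t)) \<le> norm (d r - d t)"
        using sum_norm_coef_le[OF F] by (simp only: norm_cut[OF F])
      also have "\<dots> \<le> e"
        using \<eta>1(2)[of r] dist[OF r] by (auto simp: dist_norm \<eta>_def)
      finally show "norm (cut F (d r) - cut F (d t)) \<le> e" by (simp add: lin)
    qed auto
    then show "norm (cut F (f s - f t - (s - t) *\<^sub>R d t)) \<le> e * norm (s - t)"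
      by (simp add: lin mult.commute)
  qed
  moreover have "\<eta> > 0" using \<eta>1(1) \<eta>2(1) by (simp add: \<eta>_def)
  ultimately show "\<exists>d'>0. \<forall>s. norm (s - t) < d' \<longrightarrow>
      norm (f s - f t - (s - t) *\<^sub>R d t) \<le> e * norm (s - t)" by blast
qed

section \<open>Diagonal evolution equations in coefficients\<close>

text \<open>Integrating factors turn the \<open>k\<close>-th equation into \<open>(e\<^bsup>m\<^sub>k r\<^esup> y\<^sub>k)' = e\<^bsup>m\<^sub>k r\<^esup> g\<^sub>k\<close>. For
  \<open>Re m\<^sub>k \<ge> 0\<close> the factor only damps, and the mean value inequality in the space of
  sequences bounds finitely many modes at once.\<close>

lemma diagonal_bound_finite:
  fixes y g :: "real \<Rightarrow> int \<Rightarrow> complex" and p p' :: "real \<Rightarrow> real"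
  assumes "s \<le> t"
    and cont: "\<And>k. continuous_on {s..t} (\<lambda>r. y r k)"
    and der: "\<And>r k. r \<in> {s<..<t} \<Longrightarrow>
      ((\<lambda>r. y r k) has_vector_derivative - m k * y r k + g r k) (at r)"
    and m: "\<And>k. Re (m k) \<ge> 0"
    and contp: "continuous_on {s..t} p"
    and derp: "\<And>r. r \<in> {s<..<t} \<Longrightarrow> (p has_vector_derivative p' r) (at r)"
    and F: "finite F" and g: "\<And>r. r \<in> {s<..<t} \<Longrightarrow> (\<Sum>k\<in>F. norm (g r k)) \<le> p' r"
  shows "(\<Sum>k\<in>F. norm (y t k)) \<le> (\<Sum>k\<in>F. norm (y s k)) + p t - p s"
proof (cases "s = t")
  case False
  with \<open>s \<le> t\<close> have "s < t" by simp
  define E where "E k r = exp (- m k * of_real (t - r))" for k r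
  define Y where "Y r = (\<Sum>k\<in>F. mode k (E k r * y r k))" for r
  have E_le: "norm (E k r) \<le> 1" if "r \<le> t" for k r
    using m[of k] that by (simp add: E_def)
  have damp: "(\<Sum>k\<in>F. norm (E k r * x k)) \<le> (\<Sum>k\<in>F. norm (x k))" if "r \<le> t" for r x
    unfolding norm_mult using E_le[OF that]
    by (intro sum_mono) (simp add: mult_left_le_one_le)
  have derE: "(E k has_vector_derivative m k * E k r) (at r)" for k r
  proof -
    have "((\<lambda>z. exp (- m k * (of_real t - z))) has_field_derivative m k * exp (- m k * (of_real t - of_real r)))
        (at (of_real r))"
      by (auto intro!: derivative_eq_intros)
    from has_vector_derivative_real_field[OF this, of UNIV] show ?thesis by (simp add: E_def[abs_def])
  qed
  have "norm (Y t - Y s) \<le> p t - p s"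
  proof (rule differentiable_bound_general[OF \<open>s < t\<close> _ contp, where f' = "\<lambda>r. \<Sum>k\<in>F. mode k (E k r * g r k)"])
    show "continuous_on {s..t} Y"
      unfolding Y_def E_def by (intro continuous_intros cont)
    fix r assume r: "s < r" "r < t"
    show "(p has_vector_derivative p' r) (at r)" using derp r by simp
    show "(Y has_vector_derivative (\<Sum>k\<in>F. mode k (E k r * g r k))) (at r)"
      unfolding Y_def
    proof (intro has_vector_derivative_sum bounded_linear.has_vector_derivative[OF bounded_linear_mode])
      fix k
      have "((\<lambda>r. E k r * y r k) has_vector_derivative
          E k r * (- m k * y r k + g r k) + m k * E k r * y r k) (at r)"
        using r by (intro has_vector_derivative_mult derE der) simp
      then show "((\<lambda>r. E k r * y r k) has_vector_derivative E k r * g r k) (at r)"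
        by (simp add: algebra_simps)
    qed
    show "norm (\<Sum>k\<in>F. mode k (E k r * g r k)) \<le> p' r"
      unfolding norm_sum_mode[OF F] using damp[of r "g r"] g[of r] r by force
  qed
  moreover have "norm (Y t) = (\<Sum>k\<in>F. norm (y t k))"
    unfolding Y_def norm_sum_mode[OF F] by (simp add: E_def)
  moreover have "norm (Y s) \<le> (\<Sum>k\<in>F. norm (y s k))"
    unfolding Y_def norm_sum_mode[OF F] using damp[OF \<open>s \<le> t\<close>] .
  ultimately show ?thesis
    using norm_triangle_ineq2[of "Y t" "Y s"] by linarith
qed simp

text \<open>The interval is half-open because the data are only given, and the solutions only continuous,
  on \<open>[0, h)\<close>. Every evolution equation below is brought into this form, with all terms that couple
  the modes collected in \<open>g\<close>.\<close>

definition diag_solution ::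
    "(int \<Rightarrow> complex) \<Rightarrow> real \<Rightarrow> real \<Rightarrow> (real \<Rightarrow> ell1) \<Rightarrow> (real \<Rightarrow> ell1) \<Rightarrow> bool"
  where "diag_solution m s h g z \<longleftrightarrow> continuous_on {s..<h} z \<and>
    (\<forall>r\<in>{s<..<h}. \<forall>k. ((\<lambda>r. coef (z r) k) has_vector_derivative
        - m k * coef (z r) k + coef (g r) k) (at r))"

lemma diag_solution_continuous: "diag_solution m s h g z \<Longrightarrow> continuous_on {s..<h} z"
  by (simp add: diag_solution_def)

lemma diag_solution_later_start:
  "diag_solution m s h g z \<Longrightarrow> s \<le> s' \<Longrightarrow> diag_solution m s' h g z"
  unfolding diag_solution_def by (auto intro: continuous_on_subset)

lemma diag_solution_diff:
  assumes "diag_solution m s h g1 z1" "diag_solution m s h g2 z2"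
  shows "diag_solution m s h (\<lambda>r. g1 r - g2 r) (\<lambda>r. z1 r - z2 r)"
  unfolding diag_solution_def
proof (intro conjI ballI allI)
  show "continuous_on {s..<h} (\<lambda>r. z1 r - z2 r)"
    using assms by (auto simp: diag_solution_def intro: continuous_on_diff)
  fix r k assume r: "r \<in> {s<..<h}"
  have "((\<lambda>r. coef (z1 r) k - coef (z2 r) k) has_vector_derivative
      (- m k * coef (z1 r) k + coef (g1 r) k) - (- m k * coef (z2 r) k + coef (g2 r) k)) (at r)"
    using assms r by (intro has_vector_derivative_diff) (auto simp: diag_solution_def)
  then show "((\<lambda>r. coef (z1 r - z2 r) k) has_vector_derivative
      - m k * coef (z1 r - z2 r) k + coef (g1 r - g2 r) k) (at r)"
    by (simp add: algebra_simps)
qed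

lemma diag_solution_bound:
  fixes p p' :: "real \<Rightarrow> real"
  assumes sol: "diag_solution m s h g z" and m: "\<And>k. Re (m k) \<ge> 0"
    and st: "s \<le> t" "t < h"
    and contp: "continuous_on {s..t} p"
    and derp: "\<And>r. r \<in> {s<..<t} \<Longrightarrow> (p has_vector_derivative p' r) (at r)"
    and g: "\<And>r. r \<in> {s<..<t} \<Longrightarrow> norm (g r) \<le> p' r"
  shows "norm (z t) \<le> norm (z s) + p t - p s"
proof (rule norm_le_finite_sums)
  fix F :: "int set" assume F: "finite F"
  have "continuous_on {s..t} z"
    using sol st by (auto simp: diag_solution_def intro: continuous_on_subset)
  then have "(\<Sum>k\<in>F. norm (coef (z t) k)) \<le> (\<Sum>k\<in>F. norm (coef (z s) k)) + p t - p s"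
  proof (intro diagonal_bound_finite[OF st(1) _ _ m contp derp F, where g = "\<lambda>r k. coef (g r) k"])
    fix r assume r: "r \<in> {s<..<t}"
    show "(\<Sum>k\<in>F. norm (coef (g r) k)) \<le> p' r"
      using sum_norm_coef_le[OF F, of "g r"] g[OF r] by simp
    fix k show "((\<lambda>r. coef (z r) k) has_vector_derivative - m k * coef (z r) k + coef (g r) k) (at r)"
      using sol r st by (simp add: diag_solution_def)
  qed (auto intro: continuous_on_coef)
  then show "(\<Sum>k\<in>F. norm (coef (z t) k)) \<le> norm (z s) + p t - p s"
    using sum_norm_coef_le[OF F, of "z s"] by simp
qed

lemma diag_solution_bound_const:
  assumes "diag_solution m s h g z" "\<And>k. Re (m k) \<ge> 0" "s \<le> t" "t < h"
    and "\<And>r. r \<in> {s<..<t} \<Longrightarrow> norm (g r) \<le> B"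
  shows "norm (z t) \<le> norm (z s) + (t - s) * B"
  using diag_solution_bound[OF assms(1-4), of "\<lambda>r. r * B" "\<lambda>_. B"] assms(5)
  by (force simp: algebra_simps intro!: continuous_intros derivative_eq_intros)

text \<open>A Gronwall argument: in the norm weighted by \<open>e\<^bsup>-2Lr\<^esup>\<close> the solution is at most half
  as large as itself.\<close>

lemma diag_solution_zero:
  assumes sol: "diag_solution m s h g z" and m: "\<And>k. Re (m k) \<ge> 0" and "z s = 0"
    and L: "L > 0" "\<And>r. r \<in> {s<..<h} \<Longrightarrow> norm (g r) \<le> L * norm (z r)"
    and t: "t \<in> {s..<h}"
  shows "z t = 0"
proof -
  define w where "w r = exp (- (2 * L * r)) * norm (z r)" for r
  have cz: "continuous_on {s..t} z"
    using sol t by (auto simp: diag_solution_def intro: continuous_on_subset)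
  have "\<exists>x\<in>{s..t}. \<forall>r\<in>{s..t}. w r \<le> w x"
    using t unfolding w_def by (intro continuous_attains_sup continuous_intros cz) auto
  then obtain x where x: "x \<in> {s..t}" "\<And>r. r \<in> {s..t} \<Longrightarrow> w r \<le> w x" by blast
  have "norm (z x) \<le> norm (z s) + w x / 2 * exp (2 * L * x) - w x / 2 * exp (2 * L * s)"
  proof (rule diag_solution_bound[OF sol m])
    fix r assume r: "r \<in> {s<..<x}"
    show "((\<lambda>r. w x / 2 * exp (2 * L * r)) has_vector_derivative L * w x * exp (2 * L * r)) (at r)"
      by (auto intro!: derivative_eq_intros simp: has_real_derivative_iff_has_vector_derivative[symmetric])
    have "norm (z r) = w r * exp (2 * L * r)" by (simp add: w_def exp_minus field_simps)
    also have "\<dots> \<le> w x * exp (2 * L * r)"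
      using x r by (intro mult_right_mono) auto
    finally have "L * norm (z r) \<le> L * (w x * exp (2 * L * r))"
      using L(1) by (intro mult_left_mono) auto
    then show "norm (g r) \<le> L * w x * exp (2 * L * r)"
      using L(2)[of r] r x(1) t by (simp add: mult.assoc)
  qed (use x t in \<open>auto intro!: continuous_intros\<close>)
  also have "\<dots> \<le> w x / 2 * exp (2 * L * x)"
    using \<open>z s = 0\<close> by (simp add: w_def)
  also have "\<dots> = norm (z x) / 2" by (simp add: w_def exp_minus field_simps)
  finally have "w x = 0" by (simp add: w_def)
  then have "w t \<le> 0" using x(2)[of t] t by simp
  then show ?thesis by (simp add: w_def mult_le_0_iff)
qed

text \<open>The largest value \<open>Z\<close> of the norm satisfies \<open>Z \<le> (t - s) (M + L Z)\<close>; the point of the bound is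
  that the factor in front of \<open>(t - s) M\<close> tends to \<open>1\<close> with the length of the interval.\<close>

lemma diag_solution_short_bound:
  assumes sol: "diag_solution m s h g z" and m: "\<And>k. Re (m k) \<ge> 0" and "z s = 0"
    and L: "L \<ge> 0" "\<And>r. r \<in> {s<..<h} \<Longrightarrow> norm (g r) \<le> M + L * norm (z r)"
    and t: "t \<in> {s..<h}" and short: "L * (t - s) \<le> 1 / 2" and "M \<ge> 0"
  shows "norm (z t) \<le> (t - s) * M * (1 + 2 * L * (t - s))"
proof -
  have cz: "continuous_on {s..t} z"
    using sol t by (auto simp: diag_solution_def intro: continuous_on_subset)
  have "\<exists>x\<in>{s..t}. \<forall>r\<in>{s..t}. norm (z r) \<le> norm (z x)"
    using t by (intro continuous_attains_sup continuous_intros cz) auto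
  then obtain x where x: "x \<in> {s..t}" "\<And>r. r \<in> {s..t} \<Longrightarrow> norm (z r) \<le> norm (z x)" by blast
  define Z where "Z = norm (z x)"
  define \<eta> where "\<eta> = L * (t - s)"
  have \<eta>: "0 \<le> \<eta>" "\<eta> \<le> 1 / 2" using L short t by (auto simp: \<eta>_def)
  have "Z \<le> norm (z s) + (x - s) * (M + L * Z)"
    unfolding Z_def
  proof (rule diag_solution_bound_const[OF sol m])
    fix r assume r: "r \<in> {s<..<x}"
    then have "L * norm (z r) \<le> L * norm (z x)"
      using x L(1) by (intro mult_left_mono) auto
    then show "norm (g r) \<le> M + L * norm (z x)"
      using L(2)[of r] r x(1) t by simp
  qed (use x t in auto)
  also have "\<dots> \<le> (t - s) * (M + L * Z)"
    using x t \<open>z s = 0\<close> L \<open>M \<ge> 0\<close> by (auto intro!: mult_right_mono simp: Z_def)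
  finally have "Z * (1 - \<eta>) \<le> (t - s) * M" by (simp add: \<eta>_def algebra_simps)
  then have "Z * (1 - \<eta>) * (1 + 2 * \<eta>) \<le> (t - s) * M * (1 + 2 * \<eta>)"
    using \<eta> by (intro mult_right_mono) auto
  moreover have "Z * 1 \<le> Z * ((1 - \<eta>) * (1 + 2 * \<eta>))"
  proof (rule mult_left_mono)
    have "\<eta> * (2 * \<eta>) \<le> \<eta> * 1" using \<eta> by (intro mult_left_mono) auto
    then show "1 \<le> (1 - \<eta>) * (1 + 2 * \<eta>)" by (simp add: algebra_simps)
  qed (simp add: Z_def)
  ultimately show ?thesis
    using x(2)[of t] t by (simp add: Z_def \<eta>_def mult.assoc)
qed

subsection \<open>Existence for the inhomogeneous problem\<close>

lemma continuous_on_half_openI: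
  fixes f :: "real \<Rightarrow> 'a::topological_space"
  assumes "\<And>T. T < h \<Longrightarrow> continuous_on {0..T} f"
  shows "continuous_on {0..<h} f"
  unfolding continuous_on_eq_continuous_within
proof
  fix x assume x: "x \<in> {0..<h}"
  define T where "T = (x + h) / 2"
  have T: "x < T" "T < h" using x by (auto simp: T_def)
  have "at x within {0..<h} = at x within {0..T}"
    by (rule at_within_nhd[of x "{..<T}"]) (use T in auto)
  moreover have "continuous (at x within {0..T}) f"
    using assms[OF T(2)] x T by (simp add: continuous_on_eq_continuous_within)
  ultimately show "continuous (at x within {0..<h}) f" by (simp add: continuous_within)
qed

text \<open>Each mode is solved by a scalar integral. Since the finite bounds pass to any set of modes,
  the tails of the solution are controlled by those of \<open>\<phi>\<close> and of \<open>g\<close>, and the latter are uniformly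
  small on compact intervals; so the modes assemble to a curve that is continuous in norm.\<close>

lemma diag_problem_solvable:
  assumes m: "\<And>k. Re (m k) \<ge> 0" and g: "continuous_on {0..<h} g"
  shows "\<exists>v. diag_solution m 0 h g v \<and> v 0 = \<phi>"
proof -
  define v where
    "v t k = exp (- m k * of_real t) * (coef \<phi> k + integral {0..t} (\<lambda>s. exp (m k * of_real s) * coef (g s) k))"
    for t k
  have g_sub: "continuous_on {0..T} g" if "T < h" for T
    using g that by (auto intro: continuous_on_subset)
  have integrand: "continuous_on {0..T} (\<lambda>s. exp (m k * of_real s) * coef (g s) k)" if "T < h" for T k
    by (intro continuous_intros g_sub that)
  have v0: "v 0 k = coef \<phi> k" for k by (simp add: v_def)
  have cont: "continuous_on {0..T} (\<lambda>t. v t k)" if "T < h" for T k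
    unfolding v_def
    by (intro continuous_intros indefinite_integral_continuous_1 integrable_continuous_real integrand that)
  have der: "((\<lambda>t. v t k) has_vector_derivative - m k * v t k + coef (g t) k) (at t)"
    if t: "t \<in> {0<..<h}" for t k
  proof -
    define T where "T = (t + h) / 2"
    have T: "t < T" "T < h" using t by (auto simp: T_def)
    have "((\<lambda>u. integral {0..u} (\<lambda>s. exp (m k * of_real s) * coef (g s) k)) has_vector_derivative
        exp (m k * of_real t) * coef (g t) k) (at t within {0..T})"
      using t T by (intro integral_has_vector_derivative integrand) auto
    then have I: "((\<lambda>u. integral {0..u} (\<lambda>s. exp (m k * of_real s) * coef (g s) k)) has_vector_derivative
        exp (m k * of_real t) * coef (g t) k) (at t)"
      using t T at_within_interior[of t "{0..T}"] by simp
    have "((\<lambda>z. exp (- m k * z)) has_field_derivative - m k * exp (- m k * of_real t)) (at (of_real t))"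
      by (auto intro!: derivative_eq_intros)
    note E = has_vector_derivative_real_field[OF this, of UNIV]
    have "((\<lambda>t. v t k) has_vector_derivative
        exp (- m k * of_real t) * (0 + exp (m k * of_real t) * coef (g t) k) +
        (- m k * exp (- m k * of_real t)) *
          (coef \<phi> k + integral {0..t} (\<lambda>s. exp (m k * of_real s) * coef (g s) k))) (at t)"
      unfolding v_def by (intro has_vector_derivative_mult E has_vector_derivative_add I has_vector_derivative_const)
    moreover have "exp (- m k * of_real t) * (0 + exp (m k * of_real t) * coef (g t) k) = coef (g t) k"
      by (simp flip: mult.assoc exp_add)
    ultimately show ?thesis by (simp only: v_def add.commute mult.assoc)
  qed
  have bound: "(\<Sum>k\<in>F. norm (v t k)) \<le> (\<Sum>k\<in>F. norm (coef \<phi> k)) + t * B"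
    if "finite F" "0 \<le> t" "t < h" "\<And>r. r \<in> {0<..<t} \<Longrightarrow> (\<Sum>k\<in>F. norm (coef (g r) k)) \<le> B" for F t B
  proof -
    have "(\<Sum>k\<in>F. norm (v t k)) \<le> (\<Sum>k\<in>F. norm (v 0 k)) + t * B - 0 * B"
    proof (rule diagonal_bound_finite[OF that(2) cont[OF that(3)] _ m _ _ that(1,4)])
      show "((\<lambda>r. v r k) has_vector_derivative - m k * v r k + coef (g r) k) (at r)"
        if "r \<in> {0<..<t}" for r k
        using that \<open>t < h\<close> by (intro der) auto
    qed (auto intro!: continuous_intros derivative_eq_intros)
    then show ?thesis by (simp add: v0)
  qed
  have summ: "v t abs_summable_on UNIV" if t: "t \<in> {0..<h}" for t
  proof -
    have "compact (g ` {0..t})"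
      using g_sub t by (intro compact_continuous_image) auto
    then obtain B where B: "\<And>r. r \<in> {0..t} \<Longrightarrow> norm (g r) \<le> B"
      using compact_imp_bounded bounded_iff by (metis imageI)
    show ?thesis
    proof (rule abs_summableI)
      fix F :: "int set" assume F: "finite F"
      have "(\<Sum>k\<in>F. norm (v t k)) \<le> (\<Sum>k\<in>F. norm (coef \<phi> k)) + t * B"
        using t by (intro bound F) (auto intro: order_trans[OF sum_norm_coef_le[OF F] B])
      then show "(\<Sum>k\<in>F. norm (v t k)) \<le> norm \<phi> + t * B"
        using sum_norm_coef_le[OF F, of \<phi>] by linarith
    qed
  qed
  define w where "w t = Abs_ell1 (v t)" for t
  have w: "coef (w t) k = v t k" if "t \<in> {0..<h}" for t k
    using summ[OF that] by (simp add: w_def coef_Abs_ell1)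
  have cw: "continuous_on {0..<h} w"
  proof (rule continuous_on_half_openI)
    fix T assume T: "T < h"
    show "continuous_on {0..T} w"
    proof (rule continuous_on_uniform_cut)
      show "continuous_on {0..T} (\<lambda>t. coef (w t) k)" for k
        using cont[OF T, of k] by (rule continuous_on_eq) (use T in \<open>simp add: w\<close>)
      show "uniform_limit {0..T} (\<lambda>F t. cut F (w t)) w (finite_subsets_at_top UNIV)"
      proof (rule uniform_limitI)
        fix e :: real assume e: "e > 0"
        define d where "d = e / (2 * (\<bar>T\<bar> + 1))"
        have d: "d > 0" "\<bar>T\<bar> * d < e / 2" using e by (auto simp: d_def field_simps)
        have "\<forall>\<^sub>F F in finite_subsets_at_top UNIV. \<forall>t\<in>{0..T}. dist (cut F (g t)) (g t) < d"
          using uniform_limitD[OF uniform_limit_cut_compact[OF compact_Icc g_sub[OF T]] d(1)] .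
        moreover have "\<forall>\<^sub>F F in finite_subsets_at_top UNIV. dist (cut F \<phi>) \<phi> < e / 2"
          using e by (intro tendstoD[OF tendsto_cut]) simp
        moreover have "\<forall>\<^sub>F F :: int set in finite_subsets_at_top UNIV. finite F"
          by (auto intro!: eventually_finite_subsets_at_top_weakI)
        ultimately show "\<forall>\<^sub>F F in finite_subsets_at_top UNIV. \<forall>t\<in>{0..T}. dist (cut F (w t)) (w t) < e"
        proof eventually_elim
          case (elim F)
          have outside: "(\<Sum>k\<in>G - F. norm (coef a k)) = (\<Sum>k\<in>G. norm (coef (a - cut F a) k))"
            if "finite G" for G a
            using elim(3) that by (intro sum.mono_neutral_cong_left) (auto simp: coef_cut)
          show ?case
          proof
            fix t assume t: "t \<in> {0..T}"
            have "norm (w t - cut F (w t)) \<le> e / 2 + T * d"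
            proof (rule norm_le_finite_sums)
              fix G :: "int set" assume G: "finite G"
              have "(\<Sum>k\<in>G. norm (coef (w t - cut F (w t)) k)) = (\<Sum>k\<in>G - F. norm (v t k))"
                using outside[OF G, of "w t"] w[of t] t T by simp
              also have "\<dots> \<le> (\<Sum>k\<in>G - F. norm (coef \<phi> k)) + t * d"
              proof (rule bound)
                fix r assume "r \<in> {0<..<t}"
                then have "norm (g r - cut F (g r)) < d"
                  using elim(1) t by (simp add: dist_norm norm_minus_commute)
                then show "(\<Sum>k\<in>G - F. norm (coef (g r) k)) \<le> d"
                  using outside[OF G, of "g r"] sum_norm_coef_le[OF G, of "g r - cut F (g r)"] by linarith
              qed (use G t T in auto)
              also have "\<dots> \<le> e / 2 + T * d"
                using outside[OF G, of \<phi>] sum_norm_coef_le[OF G, of "\<phi> - cut F \<phi>"] elim(2) t d(1)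
                by (intro add_mono mult_right_mono) (auto simp: dist_norm norm_minus_commute)
              finally show "(\<Sum>k\<in>G. norm (coef (w t - cut F (w t)) k)) \<le> e / 2 + T * d" .
            qed
            then show "dist (cut F (w t)) (w t) < e"
              using d(2) t by (simp add: dist_norm norm_minus_commute)
          qed
        qed
      qed
    qed
  qed
  have "diag_solution m 0 h g w"
    unfolding diag_solution_def
  proof (intro conjI ballI allI cw)
    fix r k assume r: "r \<in> {0<..<h}"
    show "((\<lambda>r. coef (w r) k) has_vector_derivative - m k * coef (w r) k + coef (g r) k) (at r)"
      by (rule has_vector_derivative_transform_within_open[where S = "{0<..<h}" and f = "\<lambda>t. v t k"])
        (use der[OF r, of k] r in \<open>auto simp: w\<close>)
  qed
  moreover have "w 0 = \<phi>"
    using coef_inject by (auto simp: w_def v0[abs_def] coef_inverse intro!: ell1_eqI)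
  ultimately show ?thesis by blast
qed

subsection \<open>Existence for a globally Lipschitz nonlinearity\<close>

text \<open>Picard iteration is a contraction in the norm weighted by \<open>e\<^bsup>-2Lt\<^esup>\<close>. The half-open interval is
  parametrized by the real line in order to use the complete space of bounded continuous functions
  on a type.\<close>

lemma diag_lipschitz_solvable:
  fixes G :: "real \<Rightarrow> ell1 \<Rightarrow> ell1"
  assumes m: "\<And>k. Re (m k) \<ge> 0" and "h > 0"
    and G: "\<And>a. continuous_on {0..<h} a \<Longrightarrow> continuous_on {0..<h} (\<lambda>t. G t (a t))"
    and L: "L > 0" "\<And>t a b. t \<in> {0..<h} \<Longrightarrow> norm (G t a - G t b) \<le> L * norm (a - b)"
    and B: "\<And>t. t \<in> {0..<h} \<Longrightarrow> norm (G t 0) \<le> B"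
  shows "\<exists>a. diag_solution m 0 h (\<lambda>t. G t (a t)) a \<and> a 0 = \<phi>"
proof -
  define \<Phi> where "\<Phi> a = (SOME v. diag_solution m 0 h (\<lambda>t. G t (a t)) v \<and> v 0 = \<phi>)" for a
  have \<Phi>: "diag_solution m 0 h (\<lambda>t. G t (a t)) (\<Phi> a)" "\<Phi> a 0 = \<phi>" if "continuous_on {0..<h} a" for a
    using someI_ex[OF diag_problem_solvable[where m = m and \<phi> = \<phi>, OF m G[OF that]]] unfolding \<Phi>_def by auto
  define \<psi> where "\<psi> x = h * (\<bar>x\<bar> / (1 + \<bar>x\<bar>))" for x :: real
  define \<sigma> where "\<sigma> t = t / (h - t)" for t :: real
  have \<psi>: "\<psi> x \<in> {0..<h}" for x
    using \<open>h > 0\<close> by (auto simp: \<psi>_def field_simps add_pos_nonneg)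
  have \<psi>_cont: "continuous_on UNIV \<psi>"
    unfolding \<psi>_def by (intro continuous_intros) (auto simp: add_pos_nonneg)
  have \<psi>\<sigma>: "\<psi> (\<sigma> t) = t" if "t \<in> {0..<h}" for t
    using that by (auto simp: \<psi>_def \<sigma>_def field_simps)
  have \<sigma>_cont: "continuous_on {0..<h} \<sigma>"
    unfolding \<sigma>_def by (intro continuous_intros) auto
  define A where "A c t = exp (2 * L * t) *\<^sub>R apply_bcontfun c (\<sigma> t)" for c :: "real \<Rightarrow>\<^sub>C ell1" and t
  have A_cont: "continuous_on {0..<h} (A c)" for c
    unfolding A_def
    by (intro continuous_intros continuous_on_compose2[OF continuous_on_apply_bcontfun \<sigma>_cont]) auto
  define f where "f c x = exp (- (2 * L * \<psi> x)) *\<^sub>R \<Phi> (A c) (\<psi> x)" for c x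
  have f: "f c \<in> bcontfun" for c
  proof -
    obtain C where C: "\<And>x. norm (apply_bcontfun c x) \<le> C"
      using bounded_apply_bcontfun[of c] unfolding bounded_iff by blast
    have AC: "norm (A c t) \<le> exp (2 * L * h) * C" if "t \<in> {0..<h}" for t
      using that L(1) C[of "\<sigma> t"] by (auto simp: A_def intro!: mult_mono)
    have rhs: "norm (G t (A c t)) \<le> B + L * (exp (2 * L * h) * C)" if t: "t \<in> {0..<h}" for t
    proof -
      have "norm (G t (A c t)) \<le> norm (G t 0) + norm (G t (A c t) - G t 0)"
        by (rule norm_triangle_sub)
      also have "\<dots> \<le> B + L * norm (A c t)" using B[OF t] L(2)[OF t, of "A c t" 0] by simp
      also have "\<dots> \<le> B + L * (exp (2 * L * h) * C)" using AC[OF t] L(1) by simp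
      finally show ?thesis .
    qed
    have "norm (\<Phi> (A c) t) \<le> norm \<phi> + h * (B + L * (exp (2 * L * h) * C))" if t: "t \<in> {0..<h}" for t
    proof -
      have "norm (\<Phi> (A c) t) \<le> norm \<phi> + (t - 0) * (B + L * (exp (2 * L * h) * C))"
        using diag_solution_bound_const[OF \<Phi>(1)[OF A_cont] m, of t] \<Phi>(2)[OF A_cont] rhs t by simp
      also have "\<dots> \<le> norm \<phi> + h * (B + L * (exp (2 * L * h) * C))"
        using t order_trans[OF norm_ge_zero rhs[OF t]] by (intro add_left_mono mult_right_mono) auto
      finally show ?thesis .
    qed
    then have "norm (f c x) \<le> norm \<phi> + h * (B + L * (exp (2 * L * h) * C))" for x
      using \<psi>[of x] L(1) mult_left_le_one_le[of "norm (\<Phi> (A c) (\<psi> x))" "exp (- (2 * L * \<psi> x))"]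
      by (fastforce simp: f_def)
    moreover have "continuous_on UNIV (f c)"
      unfolding f_def using \<psi>
      by (intro continuous_intros \<psi>_cont
          continuous_on_compose2[OF diag_solution_continuous[OF \<Phi>(1)[OF A_cont]] \<psi>_cont]) auto
    ultimately show ?thesis by (intro bcontfun_normI)
  qed
  have contraction: "dist (Bcontfun (f c)) (Bcontfun (f d)) \<le> 1 / 2 * dist c d" for c d
  proof (rule dist_bound)
    fix x
    define t where "t = \<psi> x"
    have t: "t \<in> {0..<h}" using \<psi> by (simp add: t_def)
    have "norm (\<Phi> (A c) t - \<Phi> (A d) t) \<le> norm (\<Phi> (A c) 0 - \<Phi> (A d) 0) +
        dist c d / 2 * exp (2 * L * t) - dist c d / 2 * exp (2 * L * 0)"
    proof (rule diag_solution_bound[OF diag_solution_diff[OF \<Phi>(1)[OF A_cont] \<Phi>(1)[OF A_cont]] m])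
      fix r assume r: "r \<in> {0<..<t}"
      show "((\<lambda>r. dist c d / 2 * exp (2 * L * r)) has_vector_derivative
          L * (exp (2 * L * r) * dist c d)) (at r)"
        by (auto intro!: derivative_eq_intros simp: has_real_derivative_iff_has_vector_derivative[symmetric])
      have "norm (A c r - A d r) = exp (2 * L * r) * dist (apply_bcontfun c (\<sigma> r)) (apply_bcontfun d (\<sigma> r))"
        by (simp add: A_def dist_norm flip: scaleR_diff_right)
      also have "\<dots> \<le> exp (2 * L * r) * dist c d" by (simp add: dist_bounded)
      finally show "norm (G r (A c r) - G r (A d r)) \<le> L * (exp (2 * L * r) * dist c d)"
        using L(2)[of r "A c r" "A d r"] L(1) r t
        by (smt (verit, best) atLeastLessThan_iff greaterThanLessThan_iff mult_left_mono)
    qed (use t in \<open>auto intro!: continuous_intros\<close>)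
    also have "\<dots> \<le> dist c d / 2 * exp (2 * L * t)" by (simp add: \<Phi>(2)[OF A_cont])
    finally have "exp (- (2 * L * t)) * norm (\<Phi> (A c) t - \<Phi> (A d) t) \<le>
        exp (- (2 * L * t)) * (dist c d / 2 * exp (2 * L * t))"
      by (intro mult_left_mono) auto
    also have "\<dots> = dist c d / 2" by (simp add: exp_minus field_simps)
    finally show "dist (apply_bcontfun (Bcontfun (f c)) x) (apply_bcontfun (Bcontfun (f d)) x) \<le> 1 / 2 * dist c d"
      by (simp add: Bcontfun_inverse[OF f] f_def dist_norm t_def flip: scaleR_diff_right)
  qed
  obtain c where c: "Bcontfun (f c) = c"
    using banach_fix_type[of "1/2" "\<lambda>c. Bcontfun (f c)"] contraction by auto
  have eq: "A c t = \<Phi> (A c) t" if t: "t \<in> {0..<h}" for t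
  proof -
    have "A c t = exp (2 * L * t) *\<^sub>R f c (\<sigma> t)"
      unfolding A_def using Bcontfun_inverse[OF f, of c] c by simp
    then show ?thesis using \<psi>\<sigma>[OF t] by (simp add: f_def exp_minus)
  qed
  have "diag_solution m 0 h (\<lambda>t. G t (\<Phi> (A c) t)) (\<Phi> (A c))"
    using \<Phi>(1)[OF A_cont, of c] eq unfolding diag_solution_def by simp
  then show ?thesis using \<Phi>(2)[OF A_cont] by blast
qed

section \<open>The perturbed linearized problem\<close>

text \<open>The symbol of \<open>-e\<^bsup>i\<theta>\<^esup> \<partial>\<^sub>x\<^sup>2\<close> on functions of period \<open>1\<close>.\<close>

definition heat :: "real \<Rightarrow> int \<Rightarrow> complex"
  where "heat \<theta> k = cis \<theta> * of_real ((real_of_int k)\<^sup>2 * \<omega>\<^sup>2)"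

lemma Re_heat: "Re (heat \<theta> k) = cos \<theta> * \<omega>\<^sup>2 * (real_of_int k)\<^sup>2"
  by (simp add: heat_def mult_ac power_mult_distrib)

lemma Re_heat_nonneg:
  assumes "\<theta> \<in> {-pi/2<..<pi/2}"
  shows "0 \<le> Re (heat \<theta> k)"
  using cos_gt_zero_pi[of \<theta>] assms by (simp add: Re_heat)

lemma cauchy_solution_iff_diag:
  "cauchy_solution \<theta> h \<phi> a \<longleftrightarrow>
    diag_solution (heat \<theta>) 0 h (\<lambda>t. cis \<theta> *\<^sub>C (a t \<star> a t)) a \<and> a 0 = \<phi>"
  unfolding cauchy_solution_def diag_solution_def heat_def by (auto simp: algebra_simps)

lemma evolution_operator_diag_solution:
  assumes "evolution_operator \<theta> h abar U" "s \<in> {0..h}"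
  shows "diag_solution (heat \<theta>) s h (\<lambda>t. cis \<theta> *\<^sub>C (2 *\<^sub>R (abar t \<star> U t s x))) (\<lambda>t. U t s x)"
    and "U s s x = x"
proof -
  note U = bspec[OF assms(1)[unfolded evolution_operator_def] assms(2), rule_format, of x]
  show "U s s x = x" using U by blast
  show "diag_solution (heat \<theta>) s h (\<lambda>t. cis \<theta> *\<^sub>C (2 *\<^sub>R (abar t \<star> U t s x))) (\<lambda>t. U t s x)"
    unfolding diag_solution_def
  proof (intro conjI ballI allI)
    show "continuous_on {s..<h} (\<lambda>t. U t s x)"
      using U by (auto intro: continuous_on_subset)
    fix t k assume "t \<in> {s<..<h}"
    then obtain d where d: "((\<lambda>r. coef (U r s x) k) has_vector_derivative d) (at t)"
      "d + cis \<theta> * (of_real ((real_of_int k)\<^sup>2 * \<omega>\<^sup>2) * coef (U t s x) k - 2 * coef (abar t \<star> U t s x) k) = 0"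
      using U by blast
    from d(2) have "d = - heat \<theta> k * coef (U t s x) k + coef (cis \<theta> *\<^sub>C (2 *\<^sub>R (abar t \<star> U t s x))) k"
      by (simp add: heat_def algebra_simps scaleR_conv_of_real add_eq_0_iff)
    with d(1) show "((\<lambda>r. coef (U r s x) k) has_vector_derivative
        - heat \<theta> k * coef (U t s x) k + coef (cis \<theta> *\<^sub>C (2 *\<^sub>R (abar t \<star> U t s x))) k) (at t)"
      by simp
  qed
qed

text \<open>Both sides solve the linearized problem on \<open>[r, h)\<close> with the same value at \<open>r\<close>.\<close>

lemma evolution_operator_compose:
  assumes \<theta>: "\<theta> \<in> {-pi/2<..<pi/2}" and U: "evolution_operator \<theta> h abar U"
    and C: "C > 0" "\<And>t. t \<in> {0..<h} \<Longrightarrow> norm (abar t) \<le> C"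
    and t: "0 \<le> s" "s \<le> r" "r \<le> t" "t < h"
  shows "U t r (U r s x) = U t s x"
proof -
  define z where "z t = U t r (U r s x) - U t s x" for t
  have "diag_solution (heat \<theta>) r h
      (\<lambda>t. cis \<theta> *\<^sub>C (2 *\<^sub>R (abar t \<star> U t r (U r s x))) - cis \<theta> *\<^sub>C (2 *\<^sub>R (abar t \<star> U t s x))) z"
    unfolding z_def using t
    by (intro diag_solution_diff evolution_operator_diag_solution[OF U]
        diag_solution_later_start[OF evolution_operator_diag_solution(1)[OF U]]) auto
  moreover have "cis \<theta> *\<^sub>C (2 *\<^sub>R (abar t \<star> U t r (U r s x))) - cis \<theta> *\<^sub>C (2 *\<^sub>R (abar t \<star> U t s x))
      = cis \<theta> *\<^sub>C (2 *\<^sub>R (abar t \<star> z t))" for t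
    by (rule ell1_eqI) (simp add: z_def conv_diff_right algebra_simps)
  ultimately have z: "diag_solution (heat \<theta>) r h (\<lambda>t. cis \<theta> *\<^sub>C (2 *\<^sub>R (abar t \<star> z t))) z" by simp
  have "z t = 0"
  proof (rule diag_solution_zero[OF z Re_heat_nonneg[OF \<theta>], where L = "2 * C"])
    show "z r = 0"
      using evolution_operator_diag_solution(2)[OF U, of r] t by (simp add: z_def)
    fix q assume "q \<in> {r<..<h}"
    then have "norm (abar q \<star> z q) \<le> C * norm (z q)"
      using t C(2)[of q] by (intro order_trans[OF norm_conv_le] mult_right_mono) auto
    then show "norm (cis \<theta> *\<^sub>C (2 *\<^sub>R (abar q \<star> z q))) \<le> 2 * C * norm (z q)" by simp
  qed (use C t in auto)
  then show ?thesis by (simp add: z_def)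
qed

text \<open>This is the estimate that the variation of constants formula
  \<open>w(t) = U(t,0) w(0) + \<integral>\<^sub>0\<^sup>t U(t,\<tau>) p(\<tau>) d\<tau>\<close> would give. It is obtained without integrating
  operator-valued functions: \<open>U(t,\<tau>) w(\<tau>)\<close> connects \<open>w(t)\<close> to \<open>U(t,0) w(0)\<close> as \<open>\<tau>\<close> decreases from
  \<open>t\<close>, and over a short interval \<open>[\<tau>, \<tau>']\<close> it changes by \<open>U(t,\<tau>')\<close> applied to
  \<open>w(\<tau>') - U(\<tau>',\<tau>) w(\<tau>)\<close>, which solves the perturbed problem with zero initial value.\<close>

lemma evolution_operator_perturbation:
  assumes \<theta>: "\<theta> \<in> {-pi/2<..<pi/2}" and U: "evolution_operator \<theta> h abar U"
    and C: "C > 0" "\<And>t. t \<in> {0..<h} \<Longrightarrow> norm (abar t) \<le> C"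
    and W: "\<And>s t. 0 \<le> s \<Longrightarrow> s \<le> t \<Longrightarrow> t \<le> h \<Longrightarrow> norm (U t s) \<le> W"
    and w: "diag_solution (heat \<theta>) 0 h (\<lambda>r. cis \<theta> *\<^sub>C (2 *\<^sub>R (abar r \<star> w r)) + p r) w"
    and p: "\<And>r. r \<in> {0<..<h} \<Longrightarrow> norm (p r) \<le> M" and t: "t \<in> {0..<h}"
  shows "norm (w t - U t 0 (w 0)) \<le> t * W * M"
proof -
  have M: "M \<ge> 0" using order_trans[OF norm_ge_zero p[of "h/2"]] t by simp
  have W0: "W \<ge> 0" using order_trans[OF norm_ge_zero W[of 0 0]] t by simp
  have step: "norm (w r - U r s (w s)) \<le> (r - s) * M * (1 + 2 * (2 * C) * (r - s))"
    if sr: "0 \<le> s" "s \<le> r" "r < h" "2 * C * (r - s) \<le> 1 / 2" for s r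
  proof -
    define z where "z r = w r - U r s (w s)" for r
    have "diag_solution (heat \<theta>) s h (\<lambda>r. (cis \<theta> *\<^sub>C (2 *\<^sub>R (abar r \<star> w r)) + p r)
        - cis \<theta> *\<^sub>C (2 *\<^sub>R (abar r \<star> U r s (w s)))) z"
      unfolding z_def using sr
      by (intro diag_solution_diff evolution_operator_diag_solution[OF U]
          diag_solution_later_start[OF w]) auto
    moreover have "(cis \<theta> *\<^sub>C (2 *\<^sub>R (abar r \<star> w r)) + p r) - cis \<theta> *\<^sub>C (2 *\<^sub>R (abar r \<star> U r s (w s)))
        = cis \<theta> *\<^sub>C (2 *\<^sub>R (abar r \<star> z r)) + p r" for r
      by (rule ell1_eqI) (simp add: z_def conv_diff_right algebra_simps)
    ultimately have z: "diag_solution (heat \<theta>) s h (\<lambda>r. cis \<theta> *\<^sub>C (2 *\<^sub>R (abar r \<star> z r)) + p r) z"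
      by simp
    have "norm (z r) \<le> (r - s) * M * (1 + 2 * (2 * C) * (r - s))"
    proof (rule diag_solution_short_bound[OF z Re_heat_nonneg[OF \<theta>]])
      show "z s = 0" using evolution_operator_diag_solution(2)[OF U, of s] sr by (simp add: z_def)
      fix q assume q: "q \<in> {s<..<h}"
      then have "norm (abar q \<star> z q) \<le> C * norm (z q)"
        using sr C(2)[of q] by (intro order_trans[OF norm_conv_le] mult_right_mono) auto
      then show "norm (cis \<theta> *\<^sub>C (2 *\<^sub>R (abar q \<star> z q)) + p q) \<le> M + 2 * C * norm (z q)"
        using p[of q] q sr norm_triangle_ineq[of "cis \<theta> *\<^sub>C (2 *\<^sub>R (abar q \<star> z q))" "p q"] by simp
    qed (use C sr M in auto)
    then show ?thesis by (simp add: z_def)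
  qed
  \<comment> \<open>\<open>b n\<close> is the bound from \<open>n\<close> equal steps; its last factor, the loss in
    \<open>diag_solution_short_bound\<close>, tends to \<open>1\<close>.\<close>
  define b where "b n = t * W * M * (1 + 4 * C * t * (1 / real n))" for n
  have "norm (w t - U t 0 (w 0)) \<le> b n" if n: "n > 0" "real n \<ge> 4 * C * t" for n
  proof -
    define \<tau> where "\<tau> i = t * (real i / real n)" for i
    define e where "e i = U t (\<tau> i) (w (\<tau> i))" for i
    define D where "D = t / real n * M * (1 + 2 * (2 * C) * (t / real n))"
    have diff: "\<tau> (Suc i) - \<tau> i = t / real n" for i by (simp add: \<tau>_def distrib_left add_divide_distrib)
    have \<tau>: "0 \<le> \<tau> i" "\<tau> i \<le> t" if "i \<le> n" for i
      using that t n mult_left_le[of "real i / real n" t] by (auto simp: \<tau>_def)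
    have "norm (e i - e 0) \<le> real i * (W * D)" if "i \<le> n" for i
      using that
    proof (induction i)
      case (Suc i)
      have "0 \<le> \<tau> (Suc i) - \<tau> i" unfolding diff using t by simp
      then have le: "\<tau> i \<le> \<tau> (Suc i)" by simp
      have "e i = U t (\<tau> (Suc i)) (U (\<tau> (Suc i)) (\<tau> i) (w (\<tau> i)))"
        unfolding e_def using Suc.prems \<tau> le t
        by (intro evolution_operator_compose[OF \<theta> U C, symmetric]) auto
      then have "e (Suc i) - e i = U t (\<tau> (Suc i)) (w (\<tau> (Suc i)) - U (\<tau> (Suc i)) (\<tau> i) (w (\<tau> i)))"
        by (simp add: e_def blinfun.diff_right)
      also have "norm \<dots> \<le> W * D"
      proof (rule order_trans[OF norm_blinfun mult_mono])
        show "norm (U t (\<tau> (Suc i))) \<le> W" using \<tau>[of "Suc i"] Suc.prems t by (intro W) auto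
        have "norm (w (\<tau> (Suc i)) - U (\<tau> (Suc i)) (\<tau> i) (w (\<tau> i))) \<le>
            (\<tau> (Suc i) - \<tau> i) * M * (1 + 2 * (2 * C) * (\<tau> (Suc i) - \<tau> i))"
          using \<tau>[of i] \<tau>[of "Suc i"] Suc.prems le t n
          by (intro step) (auto simp: diff field_simps)
        then show "norm (w (\<tau> (Suc i)) - U (\<tau> (Suc i)) (\<tau> i) (w (\<tau> i))) \<le> D"
          unfolding diff D_def .
      qed (use W0 in auto)
      finally have "norm (e (Suc i) - e i) \<le> W * D" .
      then have "norm ((e (Suc i) - e i) + (e i - e 0)) \<le> W * D + real i * (W * D)"
        using Suc.IH Suc.prems by (intro norm_triangle_mono) auto
      then show ?case by (simp add: algebra_simps)
    qed simp
    from this[of n] have "norm (e n - e 0) \<le> real n * (W * D)" by simp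
    also have "\<dots> = b n" using n by (simp add: b_def D_def field_simps)
    finally show ?thesis
      using n evolution_operator_diag_solution(2)[OF U, of t] t by (simp add: e_def \<tau>_def)
  qed
  then have le: "\<forall>n\<ge>max 1 (nat \<lceil>4 * C * t\<rceil>). norm (w t - U t 0 (w 0)) \<le> b n"
    by (auto simp: nat_ceiling_le_eq)
  have "b \<longlonglongrightarrow> t * W * M * (1 + 4 * C * t * 0)"
    unfolding b_def by (intro tendsto_intros lim_1_over_n)
  then have "norm (w t - U t 0 (w 0)) \<le> t * W * M * (1 + 4 * C * t * 0)"
    by (rule LIMSEQ_le_const) (use le in blast)
  then show ?thesis by simp
qed

section \<open>The enclosure\<close>

definition radial_retraction :: "real \<Rightarrow> 'a::real_normed_vector \<Rightarrow> 'a"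
  where "radial_retraction \<rho> x = (\<rho> / max \<rho> (norm x)) *\<^sub>R x"

lemma radial_retraction_id: "\<rho> > 0 \<Longrightarrow> norm x \<le> \<rho> \<Longrightarrow> radial_retraction \<rho> x = x"
  by (simp add: radial_retraction_def max_def)

lemma norm_radial_retraction: "\<rho> > 0 \<Longrightarrow> norm (radial_retraction \<rho> x) \<le> \<rho>"
  by (simp add: radial_retraction_def field_simps max_def)

lemma continuous_on_radial_retraction:
  fixes f :: "'a::topological_space \<Rightarrow> 'b::real_normed_vector"
  assumes "\<rho> > 0" "continuous_on S f"
  shows "continuous_on S (\<lambda>t. radial_retraction \<rho> (f t))"
  unfolding radial_retraction_def using assms(1)
  by (intro continuous_intros assms(2)) (auto simp: max_def)

lemma radial_retraction_lipschitz:
  assumes "\<rho> > 0"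
  shows "norm (radial_retraction \<rho> x - radial_retraction \<rho> y) \<le> 2 * norm (x - y)"
proof -
  define p q where "p = max \<rho> (norm x)" and "q = max \<rho> (norm y)"
  have pq: "p \<ge> \<rho>" "q \<ge> \<rho>" "p > 0" "q > 0" "norm y \<le> q" "\<bar>q - p\<bar> \<le> norm (x - y)"
    using assms norm_triangle_ineq3[of x y] by (auto simp: p_def q_def max_def)
  have "radial_retraction \<rho> x - radial_retraction \<rho> y
      = (\<rho> / p) *\<^sub>R (x - y) + (\<rho> / p * ((q - p) / q)) *\<^sub>R y"
    unfolding radial_retraction_def p_def[symmetric] q_def[symmetric] using pq
    by (simp add: scaleR_diff_right diff_divide_distrib right_diff_distrib scaleR_diff_left)
  also have "norm \<dots> \<le> \<rho> / p * norm (x - y) + \<rho> / p * (\<bar>q - p\<bar> * (norm y / q))"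
    using assms pq by (intro order_trans[OF norm_triangle_ineq]) (simp add: abs_mult)
  also have "\<dots> \<le> 1 * norm (x - y) + 1 * (norm (x - y) * 1)"
    using assms pq by (intro add_mono mult_mono) auto
  finally show ?thesis by simp
qed

text \<open>The nonlinearity is made globally Lipschitz by cutting off the deviation from \<open>abar\<close> at
  radius \<open>\<rho>\<close>. The modified problem is solvable on all of \<open>[0, h)\<close>; its deviation satisfies the
  linearized problem perturbed by at most \<open>\<rho>\<^sup>2 + \<delta>\<close>, hence stays in the ball, inside which the
  cut-off is the identity.\<close>

lemma cauchy_solution_enclosure:
  assumes \<theta>: "\<theta> \<in> {-pi/2<..<pi/2}" and "h > 0" and U: "evolution_operator \<theta> h abar U"
    and C: "C > 0" "\<And>t. t \<in> {0..<h} \<Longrightarrow> norm (abar t) \<le> C"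
    and W: "\<And>s t. 0 \<le> s \<Longrightarrow> s \<le> t \<Longrightarrow> t \<le> h \<Longrightarrow> norm (U t s) \<le> W"
    and abar: "diag_solution (heat \<theta>) 0 h (\<lambda>r. cis \<theta> *\<^sub>C (abar r \<star> abar r) + R r) abar"
    and R: "\<And>r. r \<in> {0<..<h} \<Longrightarrow> norm (R r) \<le> \<delta>"
    and \<epsilon>: "norm (\<phi> - abar 0) \<le> \<epsilon>" and "\<rho> > 0"
    and small: "W * (\<epsilon> + h * (\<rho>\<^sup>2 + \<delta>)) \<le> \<rho>"
  obtains a where "cauchy_solution \<theta> h \<phi> a" "\<And>t. t \<in> {0..<h} \<Longrightarrow> norm (a t - abar t) \<le> \<rho>"
proof -
  define P :: "ell1 \<Rightarrow> ell1" where "P = radial_retraction \<rho>"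
  define G where "G t a = cis \<theta> *\<^sub>C (2 *\<^sub>R (abar t \<star> a) - abar t \<star> abar t
    + P (a - abar t) \<star> P (a - abar t))" for t a
  have P: "norm (P x) \<le> \<rho>" "norm (P x - P y) \<le> 2 * norm (x - y)" for x y
    using norm_radial_retraction[OF \<open>\<rho> > 0\<close>] radial_retraction_lipschitz[OF \<open>\<rho> > 0\<close>]
    by (auto simp: P_def)
  note abar_cont = diag_solution_continuous[OF abar]
  have "\<exists>a. diag_solution (heat \<theta>) 0 h (\<lambda>t. G t (a t)) a \<and> a 0 = \<phi>"
  proof (rule diag_lipschitz_solvable[OF Re_heat_nonneg[OF \<theta>] \<open>h > 0\<close>,
        where L = "2 * C + 4 * \<rho>" and B = "C\<^sup>2 + \<rho>\<^sup>2"])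
    show "continuous_on {0..<h} (\<lambda>t. G t (a t))" if "continuous_on {0..<h} a" for a
      unfolding G_def P_def
      by (intro continuous_intros continuous_on_radial_retraction that abar_cont \<open>\<rho> > 0\<close>)
    show "2 * C + 4 * \<rho> > 0" using C \<open>\<rho> > 0\<close> by simp
    fix t assume t: "t \<in> {0..<h}"
    have sq: "norm (P x \<star> P x) \<le> \<rho>\<^sup>2" for x
      using mult_mono[OF P(1) P(1), of x x] \<open>\<rho> > 0\<close>
      by (intro order_trans[OF norm_conv_le]) (simp add: power2_eq_square)
    have sqC: "norm (abar t \<star> abar t) \<le> C\<^sup>2"
      using mult_mono[OF C(2)[OF t] C(2)[OF t]] C
      by (intro order_trans[OF norm_conv_le]) (simp add: power2_eq_square)
    show "norm (G t 0) \<le> C\<^sup>2 + \<rho>\<^sup>2"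
      using norm_triangle_ineq[of "- (abar t \<star> abar t)" "P (- abar t) \<star> P (- abar t)"]
        sq[of "- abar t"] sqC
      by (simp add: G_def bounded_bilinear.zero_right[OF bounded_bilinear_conv])
    fix a b
    define x y where "x = a - abar t" and "y = b - abar t"
    have "G t a - G t b = cis \<theta> *\<^sub>C (2 *\<^sub>R (abar t \<star> (a - b)) + (P x + P y) \<star> (P x - P y))"
      unfolding conv_square_diff[symmetric]
      by (rule ell1_eqI) (simp add: G_def x_def y_def conv_diff_right algebra_simps)
    then have "norm (G t a - G t b) \<le> 2 * norm (abar t \<star> (a - b)) + norm ((P x + P y) \<star> (P x - P y))"
      using norm_triangle_ineq[of "2 *\<^sub>R (abar t \<star> (a - b))" "(P x + P y) \<star> (P x - P y)"] by simp
    also have "\<dots> \<le> 2 * (C * norm (a - b)) + (\<rho> + \<rho>) * (2 * norm (a - b))"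
    proof (rule add_mono)
      show "2 * norm (abar t \<star> (a - b)) \<le> 2 * (C * norm (a - b))"
        using C(2)[OF t] by (intro mult_left_mono order_trans[OF norm_conv_le] mult_right_mono) auto
      have "norm (P x - P y) \<le> 2 * norm (a - b)" using P(2)[of x y] by (simp add: x_def y_def)
      moreover have "norm (P x + P y) \<le> \<rho> + \<rho>" using P(1) by (intro norm_triangle_mono) auto
      ultimately show "norm ((P x + P y) \<star> (P x - P y)) \<le> (\<rho> + \<rho>) * (2 * norm (a - b))"
        using \<open>\<rho> > 0\<close> by (intro order_trans[OF norm_conv_le] mult_mono) auto
    qed
    finally show "norm (G t a - G t b) \<le> (2 * C + 4 * \<rho>) * norm (a - b)"
      by (simp add: algebra_simps)
  qed
  then obtain a where a: "diag_solution (heat \<theta>) 0 h (\<lambda>t. G t (a t)) a" "a 0 = \<phi>" by blast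
  define w where "w t = a t - abar t" for t
  define p where "p t = cis \<theta> *\<^sub>C (P (w t) \<star> P (w t)) - R t" for t
  have "G t (a t) - (cis \<theta> *\<^sub>C (abar t \<star> abar t) + R t) = cis \<theta> *\<^sub>C (2 *\<^sub>R (abar t \<star> w t)) + p t" for t
    by (rule ell1_eqI)
      (simp add: G_def p_def w_def conv_diff_right algebra_simps scaleR_conv_of_real)
  with diag_solution_diff[OF a(1) abar]
  have w: "diag_solution (heat \<theta>) 0 h (\<lambda>t. cis \<theta> *\<^sub>C (2 *\<^sub>R (abar t \<star> w t)) + p t) w"
    by (simp add: w_def[symmetric])
  have p: "norm (p r) \<le> \<rho>\<^sup>2 + \<delta>" if "r \<in> {0<..<h}" for r
  proof -
    have "norm (P (w r) \<star> P (w r)) \<le> \<rho>\<^sup>2"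
      using mult_mono[OF P(1) P(1), of "w r" "w r"] \<open>\<rho> > 0\<close>
      by (intro order_trans[OF norm_conv_le]) (simp add: power2_eq_square)
    then show ?thesis
      using R[OF that] norm_triangle_ineq4[of "cis \<theta> *\<^sub>C (P (w r) \<star> P (w r))" "R r"]
      by (simp add: p_def)
  qed
  have w_le: "norm (w t) \<le> \<rho>" if t: "t \<in> {0..<h}" for t
  proof -
    have W0: "W \<ge> 0" using order_trans[OF norm_ge_zero W[of 0 0]] t by simp
    have pos: "\<rho>\<^sup>2 + \<delta> \<ge> 0" using order_trans[OF norm_ge_zero p[of "h/2"]] \<open>h > 0\<close> by simp
    have "norm (w t) \<le> norm (w t - U t 0 (w 0)) + norm (U t 0 (w 0))"
      by (metis add.commute norm_triangle_sub)
    also have "\<dots> \<le> t * W * (\<rho>\<^sup>2 + \<delta>) + W * \<epsilon>"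
    proof (rule add_mono)
      show "norm (w t - U t 0 (w 0)) \<le> t * W * (\<rho>\<^sup>2 + \<delta>)"
        by (rule evolution_operator_perturbation[OF \<theta> U C W w p t])
      show "norm (U t 0 (w 0)) \<le> W * \<epsilon>"
        using W[of 0 t] t \<epsilon> a(2) W0
        by (intro order_trans[OF norm_blinfun] mult_mono) (auto simp: w_def)
    qed
    also have "t * W * (\<rho>\<^sup>2 + \<delta>) \<le> h * W * (\<rho>\<^sup>2 + \<delta>)"
      using t W0 pos by (intro mult_right_mono) auto
    finally show ?thesis using small by (simp add: algebra_simps)
  qed
  have G_eq: "G t (a t) = cis \<theta> *\<^sub>C (a t \<star> a t)" if t: "t \<in> {0..<h}" for t
  proof -
    have "a t \<star> a t - abar t \<star> abar t = 2 *\<^sub>R (abar t \<star> w t) + w t \<star> w t"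
      unfolding conv_square_diff
      by (simp add: w_def conv_diff_right conv_diff_left bounded_bilinear.add_left[OF bounded_bilinear_conv]
          conv_commute[of "a t" "abar t"] scaleR_2 algebra_simps)
    moreover have "P (w t) = w t" using radial_retraction_id[OF \<open>\<rho> > 0\<close> w_le[OF t]] by (simp add: P_def)
    moreover have "2 *\<^sub>R (abar t \<star> a t) - abar t \<star> abar t = 2 *\<^sub>R (abar t \<star> w t) + abar t \<star> abar t"
      by (simp add: w_def conv_diff_right scaleR_2)
    ultimately have "2 *\<^sub>R (abar t \<star> a t) - abar t \<star> abar t + P (w t) \<star> P (w t) = a t \<star> a t"
      by (simp add: algebra_simps)
    then show ?thesis by (simp add: G_def w_def)
  qed
  have "diag_solution (heat \<theta>) 0 h (\<lambda>t. cis \<theta> *\<^sub>C (a t \<star> a t)) a"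
    using a(1) G_eq unfolding diag_solution_def by simp
  then have "cauchy_solution \<theta> h \<phi> a" using a(2) by (simp add: cauchy_solution_iff_diag)
  then show ?thesis using w_le that by (simp add: w_def)
qed

text \<open>The difference of two solutions is driven by \<open>(a + b) \<star> (a - b)\<close>, which boundedness makes
  linearly small in the difference.\<close>

lemma cauchy_solution_unique:
  assumes \<theta>: "\<theta> \<in> {-pi/2<..<pi/2}"
    and a: "cauchy_solution \<theta> h \<phi> a" "\<And>t. t \<in> {0<..<h} \<Longrightarrow> norm (a t) \<le> K"
    and b: "cauchy_solution \<theta> h \<phi> b" "\<And>t. t \<in> {0<..<h} \<Longrightarrow> norm (b t) \<le> K"
    and t: "t \<in> {0..<h}"
  shows "a t = b t"
proof -
  define z where "z r = a r - b r" for r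
  have z: "diag_solution (heat \<theta>) 0 h (\<lambda>r. cis \<theta> *\<^sub>C (a r \<star> a r) - cis \<theta> *\<^sub>C (b r \<star> b r)) z"
    unfolding z_def using a b by (intro diag_solution_diff) (auto simp: cauchy_solution_iff_diag)
  have K: "K \<ge> 0" using order_trans[OF norm_ge_zero a(2)[of "h/2"]] t by simp
  have "z t = 0"
  proof (rule diag_solution_zero[OF z Re_heat_nonneg[OF \<theta>] _ _ _ t, where L = "2 * K + 1"])
    show "z 0 = 0" using a b by (simp add: z_def cauchy_solution_def)
    show "2 * K + 1 > 0" using K by simp
    fix r assume r: "r \<in> {0<..<h}"
    have "cis \<theta> *\<^sub>C (a r \<star> a r) - cis \<theta> *\<^sub>C (b r \<star> b r) = cis \<theta> *\<^sub>C ((a r + b r) \<star> z r)"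
      unfolding z_def conv_square_diff[symmetric] by (rule ell1_eqI) (simp add: algebra_simps)
    then have "norm (cis \<theta> *\<^sub>C (a r \<star> a r) - cis \<theta> *\<^sub>C (b r \<star> b r)) \<le> norm (a r + b r) * norm (z r)"
      using norm_conv_le[of "a r + b r" "z r"] by simp
    also have "\<dots> \<le> (2 * K + 1) * norm (z r)"
      using a(2)[OF r] b(2)[OF r] norm_triangle_ineq[of "a r" "b r"] by (intro mult_right_mono) auto
    finally show "norm (cis \<theta> *\<^sub>C (a r \<star> a r) - cis \<theta> *\<^sub>C (b r \<star> b r)) \<le> (2 * K + 1) * norm (z r)" .
  qed
  then show ?thesis by (simp add: z_def)
qed

section \<open>Smoothing\<close>

text \<open>Multiplication of the \<open>k\<close>-th coefficient by \<open>exp (\<sigma> min(\<bar>k\<bar>, K))\<close>, written as a finite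
  correction of a scalar multiple so that boundedness and continuity are evident.\<close>

definition exp_weight :: "int \<Rightarrow> real \<Rightarrow> ell1 \<Rightarrow> ell1"
  where "exp_weight K \<sigma> a = exp (\<sigma> * K) *\<^sub>R a +
    (\<Sum>k\<in>{-K..K}. mode k ((exp (\<sigma> * \<bar>k\<bar>) - exp (\<sigma> * K)) *\<^sub>R coef a k))"

lemma coef_exp_weight: "coef (exp_weight K \<sigma> a) k = exp (\<sigma> * min \<bar>k\<bar> K) *\<^sub>R coef a k"
  by (auto simp: exp_weight_def algebra_simps min_def)

lemma exp_weight_zero: "exp_weight K 0 a = a"
  by (rule ell1_eqI) (simp add: coef_exp_weight)

text \<open>The weight is submultiplicative because \<open>min(\<bar>k\<bar>, K)\<close> is subadditive in \<open>k\<close>.\<close>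

lemma norm_exp_weight_conv:
  assumes "\<sigma> \<ge> 0" "K \<ge> 0"
  shows "norm (exp_weight K \<sigma> (a \<star> b)) \<le> norm (exp_weight K \<sigma> a) * norm (exp_weight K \<sigma> b)"
proof (rule norm_le_conv)
  fix k
  let ?e = "\<lambda>k. exp (\<sigma> * min \<bar>k\<bar> K)"
  have sub: "?e k \<le> ?e (k - m) * ?e m" for m
  proof -
    have "min \<bar>k\<bar> K \<le> min \<bar>k - m\<bar> K + min \<bar>m\<bar> K" using assms(2) by linarith
    then have "real_of_int (min \<bar>k\<bar> K) \<le> min \<bar>k - m\<bar> K + min \<bar>m\<bar> K" by linarith
    then have "\<sigma> * min \<bar>k\<bar> K \<le> \<sigma> * (min \<bar>k - m\<bar> K + min \<bar>m\<bar> K)"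
      using assms(1) by (rule mult_left_mono)
    then show ?thesis by (simp add: distrib_left flip: exp_add)
  qed
  have "norm (coef (exp_weight K \<sigma> (a \<star> b)) k) \<le> ?e k * (\<Sum>\<^sub>\<infinity>m. norm (coef a (k - m) * coef b m))"
    by (simp add: coef_exp_weight coef_conv norm_infsum_bound[OF conv_row_summable])
  also have "\<dots> = (\<Sum>\<^sub>\<infinity>m. ?e k * norm (coef a (k - m) * coef b m))"
    by (rule infsum_cmult_right'[symmetric])
  also have "\<dots> \<le> (\<Sum>\<^sub>\<infinity>m. norm (coef (exp_weight K \<sigma> a) (k - m) * coef (exp_weight K \<sigma> b) m))"
  proof (rule infsum_mono)
    show "(\<lambda>m. ?e k * norm (coef a (k - m) * coef b m)) summable_on UNIV"
      by (rule summable_on_cmult_right[OF conv_row_summable])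
    show "(\<lambda>m. norm (coef (exp_weight K \<sigma> a) (k - m) * coef (exp_weight K \<sigma> b) m)) summable_on UNIV"
      by (rule conv_row_summable)
    fix m
    have "?e k * norm (coef a (k - m) * coef b m) \<le> (?e (k - m) * ?e m) * norm (coef a (k - m) * coef b m)"
      using sub by (intro mult_right_mono) auto
    then show "?e k * norm (coef a (k - m) * coef b m)
        \<le> norm (coef (exp_weight K \<sigma> a) (k - m) * coef (exp_weight K \<sigma> b) m)"
      by (simp add: coef_exp_weight norm_mult mult_ac)
  qed
  finally show "norm (coef (exp_weight K \<sigma> (a \<star> b)) k)
      \<le> (\<Sum>\<^sub>\<infinity>m. norm (coef (exp_weight K \<sigma> a) (k - m) * coef (exp_weight K \<sigma> b) m))" .
qed

text \<open>The weight \<open>exp (c (r - t\<^sub>0) \<bar>k\<bar>)\<close> grows at the rate \<open>c \<bar>k\<bar> \<le> c k\<^sup>2\<close>, which the diffusion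
  compensates, so the weighted solution obeys the same quadratic inequality as the solution and stays
  below \<open>2 R\<close> for a time that depends on \<open>R\<close> only. Truncating the weight at \<open>K\<close> makes the weighted
  norm finite and continuous beforehand.\<close>

lemma exp_weight_bound:
  assumes \<theta>: "\<theta> \<in> {-pi/2<..<pi/2}"
    and a: "diag_solution (heat \<theta>) 0 h (\<lambda>t. cis \<theta> *\<^sub>C (a t \<star> a t)) a"
    and R: "R > 0" "\<And>t. t \<in> {0..<h} \<Longrightarrow> norm (a t) \<le> R"
    and t: "0 \<le> t0" "t0 \<le> t1" "t1 < h" "4 * R * (t1 - t0) < 1" and "K \<ge> 0"
  shows "norm (exp_weight K (cos \<theta> * \<omega>\<^sup>2 * (t1 - t0)) (a t1)) \<le> 2 * R"
proof -
  define c where "c = cos \<theta> * \<omega>\<^sup>2"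
  have c: "c > 0" using cos_gt_zero_pi[of \<theta>] \<theta> by (simp add: c_def)
  define b where "b r = exp_weight K (c * (r - t0)) (a r)" for r
  have cont: "continuous_on {t0..<h} b"
  proof -
    have "continuous_on {t0..<h} a"
      using diag_solution_continuous[OF a] t by (auto intro: continuous_on_subset)
    then show ?thesis unfolding b_def exp_weight_def by (intro continuous_intros)
  qed
  \<comment> \<open>Differentiating the weight lowers the damping rate of the \<open>k\<close>-th mode by \<open>c min(\<bar>k\<bar>, K)\<close>.\<close>
  define m where "m k = heat \<theta> k - of_real (c * min \<bar>k\<bar> K)" for k
  have m: "Re (m k) \<ge> 0" for k
  proof -
    have "min \<bar>k\<bar> K \<le> k\<^sup>2"
      using self_le_power[of "\<bar>k\<bar>" 2] by (cases "k = 0") (auto simp: min_le_iff_disj \<open>K \<ge> 0\<close>)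
    then have "real_of_int (min \<bar>k\<bar> K) \<le> real_of_int (k\<^sup>2)" by linarith
    then have "c * min \<bar>k\<bar> K \<le> c * (real_of_int k)\<^sup>2" using c by (simp add: of_int_power)
    then show ?thesis by (simp add: m_def Re_heat c_def)
  qed
  have sol: "diag_solution m t0 h (\<lambda>r. cis \<theta> *\<^sub>C exp_weight K (c * (r - t0)) (a r \<star> a r)) b"
    unfolding diag_solution_def
  proof (intro conjI ballI allI cont)
    fix r k assume r: "r \<in> {t0<..<h}"
    let ?e = "\<lambda>r. exp (c * (r - t0) * min \<bar>k\<bar> K)"
    have "(?e has_vector_derivative c * min \<bar>k\<bar> K * ?e r) (at r)"
      by (auto intro!: derivative_eq_intros simp: has_real_derivative_iff_has_vector_derivative[symmetric])
    moreover have "((\<lambda>r. coef (a r) k) has_vector_derivative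
        - heat \<theta> k * coef (a r) k + coef (cis \<theta> *\<^sub>C (a r \<star> a r)) k) (at r)"
      using a r t by (simp add: diag_solution_def)
    ultimately have "((\<lambda>r. ?e r *\<^sub>R coef (a r) k) has_vector_derivative
        ?e r *\<^sub>R (- heat \<theta> k * coef (a r) k + coef (cis \<theta> *\<^sub>C (a r \<star> a r)) k)
        + (c * min \<bar>k\<bar> K * ?e r) *\<^sub>R coef (a r) k) (at r)"
      by (intro has_vector_derivative_scaleR) (simp add: has_real_derivative_iff_has_vector_derivative)
    then show "((\<lambda>r. coef (b r) k) has_vector_derivative - m k * coef (b r) k
        + coef (cis \<theta> *\<^sub>C exp_weight K (c * (r - t0)) (a r \<star> a r)) k) (at r)"
      by (simp add: b_def coef_exp_weight m_def algebra_simps scaleR_conv_of_real)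
  qed
  have "norm (b t1) \<le> 2 * R"
  proof (rule ccontr)
    assume "\<not> norm (b t1) \<le> 2 * R"
    \<comment> \<open>Up to the first time at which the norm reaches \<open>2 R\<close>, it can have grown by less than \<open>R\<close>.\<close>
    define S where "S = {r \<in> {t0..t1}. 2 * R \<le> norm (b r)}"
    have "continuous_on {t0..t1} b" using cont t by (auto intro: continuous_on_subset)
    then have "closed S"
      unfolding S_def by (intro continuous_on_closed_Collect_le continuous_intros) auto
    moreover have "S \<subseteq> {t0..t1}" by (auto simp: S_def)
    ultimately have "compact S"
      using compact_Int_closed[OF compact_Icc[of t0 t1], of S] by (simp add: inf.absorb2)
    moreover have "S \<noteq> {}" using \<open>\<not> norm (b t1) \<le> 2 * R\<close> t by (auto simp: S_def)
    ultimately have "\<exists>x\<in>S. \<forall>y\<in>S. x \<le> y" by (rule compact_attains_inf)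
    then obtain x where x: "x \<in> S" "\<And>y. y \<in> S \<Longrightarrow> x \<le> y" by blast
    have "norm (b x) \<le> norm (b t0) + (x - t0) * (2 * R)\<^sup>2"
    proof (rule diag_solution_bound_const[OF sol m])
      fix r assume r: "r \<in> {t0<..<x}"
      then have "r \<notin> S" using x(2)[of r] by auto
      then have "norm (b r) \<le> 2 * R" using r x(1) by (auto simp: S_def)
      then have "norm (b r) * norm (b r) \<le> (2 * R)\<^sup>2"
        unfolding power2_eq_square by (intro mult_mono) (use R in auto)
      then show "norm (cis \<theta> *\<^sub>C exp_weight K (c * (r - t0)) (a r \<star> a r)) \<le> (2 * R)\<^sup>2"
        using norm_exp_weight_conv[of "c * (r - t0)" K "a r" "a r"] c r \<open>K \<ge> 0\<close>
        by (simp add: b_def)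
    qed (use x t in \<open>auto simp: S_def\<close>)
    also have "norm (b t0) \<le> R" using R(2)[of t0] t by (simp add: b_def exp_weight_zero)
    also have "(x - t0) * (2 * R)\<^sup>2 \<le> (t1 - t0) * (2 * R)\<^sup>2"
      using x by (intro mult_right_mono) (auto simp: S_def)
    also have "(t1 - t0) * (2 * R)\<^sup>2 = R * (4 * R * (t1 - t0))" by (simp add: power2_eq_square)
    also have "\<dots> < R * 1" using t(4) R(1) by (intro mult_strict_left_mono)
    finally show False using x by (simp add: S_def)
  qed
  then show ?thesis by (simp add: b_def c_def)
qed

text \<open>Starting the weight at time \<open>t - \<Delta>\<close> instead of \<open>0\<close>, with one \<open>\<Delta>\<close> for all \<open>t \<ge> t\<^sub>1\<close>, makes the
  decay uniform in time.\<close>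

lemma cauchy_solution_exp_decay:
  assumes \<theta>: "\<theta> \<in> {-pi/2<..<pi/2}"
    and a: "cauchy_solution \<theta> h \<phi> a" and R: "\<And>t. t \<in> {0..<h} \<Longrightarrow> norm (a t) \<le> R"
    and t1: "0 < t1" "t1 < h"
  obtains \<kappa> D :: real where "\<kappa> > 0" "\<And>t k. t \<in> {t1..<h} \<Longrightarrow> norm (coef (a t) k) \<le> D * exp (- (\<kappa> * \<bar>k\<bar>))"
proof -
  define R' where "R' = \<bar>R\<bar> + 1"
  have R': "R' > 0" "\<And>t. t \<in> {0..<h} \<Longrightarrow> norm (a t) \<le> R'" using R by (fastforce simp: R'_def)+
  define \<Delta> where "\<Delta> = min t1 (1 / (8 * R'))"
  have \<Delta>: "\<Delta> > 0" "\<Delta> \<le> t1" "4 * R' * \<Delta> < 1"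
  proof -
    have "4 * R' * \<Delta> \<le> 4 * R' * (1 / (8 * R'))"
      using R'(1) by (intro mult_left_mono) (auto simp: \<Delta>_def)
    then show "4 * R' * \<Delta> < 1" using R'(1) by simp
  qed (use R' t1 in \<open>auto simp: \<Delta>_def\<close>)
  define \<kappa> where "\<kappa> = cos \<theta> * \<omega>\<^sup>2 * \<Delta>"
  have \<kappa>: "\<kappa> > 0" using cos_gt_zero_pi[of \<theta>] \<theta> \<Delta> by (simp add: \<kappa>_def)
  have "norm (coef (a t) k) \<le> 2 * R' * exp (- (\<kappa> * \<bar>k\<bar>))" if t: "t \<in> {t1..<h}" for t k
  proof -
    have "norm (exp_weight \<bar>k\<bar> (cos \<theta> * \<omega>\<^sup>2 * (t - (t - \<Delta>))) (a t)) \<le> 2 * R'"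
      using a t \<Delta> by (intro exp_weight_bound[OF \<theta> _ R']) (auto simp: cauchy_solution_iff_diag)
    then have "norm (coef (exp_weight \<bar>k\<bar> \<kappa> (a t)) k) \<le> 2 * R'"
      using norm_coef_le[of "exp_weight \<bar>k\<bar> \<kappa> (a t)" k] by (simp add: \<kappa>_def)
    then show ?thesis by (simp add: coef_exp_weight exp_minus field_simps)
  qed
  with \<kappa> show ?thesis by (rule that)
qed

lemma summable_exp_int:
  fixes \<kappa> :: real
  assumes "\<kappa> > 0"
  shows "(\<lambda>k::int. exp (- (\<kappa> * \<bar>k\<bar>))) summable_on UNIV"
proof -
  have "summable (\<lambda>n. exp (- \<kappa>) ^ n)" using assms by (intro summable_geometric) simp
  then have "summable (\<lambda>n. exp (- (\<kappa> * real n)))"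
    by (simp add: mult.commute flip: exp_of_nat_mult)
  then have nat: "(\<lambda>n. exp (- (\<kappa> * real n))) summable_on (UNIV :: nat set)"
    by (subst summable_on_UNIV_nonneg_real_iff) auto
  have "(\<lambda>k::int. exp (- (\<kappa> * \<bar>k\<bar>))) summable_on range int"
    using nat by (subst summable_on_reindex) (auto simp: o_def)
  moreover have "(\<lambda>k::int. exp (- (\<kappa> * \<bar>k\<bar>))) summable_on range (\<lambda>n. - int n)"
    using nat by (subst summable_on_reindex) (auto simp: o_def inj_on_def)
  moreover have "range int \<union> range (\<lambda>n. - int n) = UNIV"
    by (auto intro: int_cases2)
  ultimately show ?thesis by (metis summable_on_union)
qed

lemma summable_square_exp_int:
  fixes \<kappa> :: real
  assumes "\<kappa> > 0"
  shows "(\<lambda>k::int. (real_of_int k)\<^sup>2 * exp (- (\<kappa> * \<bar>k\<bar>))) summable_on UNIV"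
proof -
  \<comment> \<open>Half of the exponential absorbs the square, since \<open>y\<^sup>2 / 2 \<le> exp y\<close>.\<close>
  have le: "(real_of_int k)\<^sup>2 * exp (- (\<kappa> * \<bar>k\<bar>)) \<le> 8 / \<kappa>\<^sup>2 * exp (- (\<kappa> / 2 * \<bar>k\<bar>))" for k :: int
  proof -
    define y where "y = \<kappa> / 2 * \<bar>real_of_int k\<bar>"
    have "y \<ge> 0" using assms by (simp add: y_def)
    then have "y\<^sup>2 / 2 \<le> exp y" using exp_lower_Taylor_quadratic[of y] by linarith
    then have "(real_of_int k)\<^sup>2 \<le> 8 / \<kappa>\<^sup>2 * exp y"
      using assms by (simp add: y_def power_mult_distrib field_simps)
    then have "(real_of_int k)\<^sup>2 * exp (- (2 * y)) \<le> 8 / \<kappa>\<^sup>2 * exp y * exp (- (2 * y))"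
      by (rule mult_right_mono) simp
    also have "\<dots> = 8 / \<kappa>\<^sup>2 * exp (- y)" by (simp flip: exp_add)
    finally show ?thesis by (simp add: y_def)
  qed
  have "(\<lambda>k::int. 8 / \<kappa>\<^sup>2 * exp (- (\<kappa> / 2 * \<bar>k\<bar>))) summable_on UNIV"
    using assms by (intro summable_on_cmult_right summable_exp_int) simp
  from Infinite_Sum.abs_summable_on_comparison_test'[OF this,
      of "\<lambda>k. (real_of_int k)\<^sup>2 * exp (- (\<kappa> * \<bar>k\<bar>))"] le
  show ?thesis by simp
qed

lemma cauchy_solution_lap:
  assumes \<theta>: "\<theta> \<in> {-pi/2<..<pi/2}"
    and a: "cauchy_solution \<theta> h \<phi> a" and R: "\<And>t. t \<in> {0..<h} \<Longrightarrow> norm (a t) \<le> R"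
  shows "\<And>t. t \<in> {0<..<h} \<Longrightarrow> a t \<in> dom_lap"
    and "continuous_on {0<..<h} (\<lambda>t. lap (a t))"
proof -
  have dom: "a t \<in> dom_lap" if t: "t \<in> {0<..<h}" for t
  proof -
    obtain \<kappa> D :: real where \<kappa>: "\<kappa> > 0" "\<And>s k. s \<in> {t..<h} \<Longrightarrow> norm (coef (a s) k) \<le> D * exp (- (\<kappa> * \<bar>k\<bar>))"
      using cauchy_solution_exp_decay[OF \<theta> a R, of t] t by auto
    have "(\<lambda>k::int. D * ((real_of_int k)\<^sup>2 * exp (- (\<kappa> * \<bar>k\<bar>)))) summable_on UNIV"
      by (intro summable_on_cmult_right summable_square_exp_int \<kappa>)
    moreover have "norm ((real_of_int k)\<^sup>2 * norm (coef (a t) k)) \<le> D * ((real_of_int k)\<^sup>2 * exp (- (\<kappa> * \<bar>k\<bar>)))" for k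
      using mult_left_mono[OF \<kappa>(2)[of t k], of "(real_of_int k)\<^sup>2"] t by (simp add: mult_ac)
    ultimately have "(\<lambda>k. norm ((real_of_int k)\<^sup>2 * norm (coef (a t) k))) summable_on UNIV"
      by (rule Infinite_Sum.abs_summable_on_comparison_test')
    then show ?thesis by (simp add: dom_lap_def)
  qed
  then show "\<And>t. t \<in> {0<..<h} \<Longrightarrow> a t \<in> dom_lap" .
  have "continuous_on {t<..<h} (\<lambda>t. lap (a t))" if t: "t \<in> {0<..<h}" for t
  proof -
    obtain \<kappa> D :: real where \<kappa>: "\<kappa> > 0" "\<And>s k. s \<in> {t..<h} \<Longrightarrow> norm (coef (a s) k) \<le> D * exp (- (\<kappa> * \<bar>k\<bar>))"
      using cauchy_solution_exp_decay[OF \<theta> a R, of t] t by auto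
    have cl: "coef (lap (a s)) k = of_real (- (real_of_int k)\<^sup>2 * \<omega>\<^sup>2) * coef (a s) k" if "s \<in> {t<..<h}" for s k
      using coef_lap[OF dom] that t by simp
    show ?thesis
    proof (rule continuous_on_dominated)
      have "continuous_on {t<..<h} a"
        using a t unfolding cauchy_solution_def by (auto intro: continuous_on_subset)
      then have "continuous_on {t<..<h} (\<lambda>s. of_real (- (real_of_int k)\<^sup>2 * \<omega>\<^sup>2) * coef (a s) k)" for k
        by (intro continuous_intros)
      then show "continuous_on {t<..<h} (\<lambda>s. coef (lap (a s)) k)" for k
        by (rule continuous_on_eq) (simp add: cl)
      show "(\<lambda>k::int. D * \<omega>\<^sup>2 * ((real_of_int k)\<^sup>2 * exp (- (\<kappa> * \<bar>k\<bar>)))) summable_on UNIV"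
        by (intro summable_on_cmult_right summable_square_exp_int \<kappa>)
      fix s k assume s: "s \<in> {t<..<h}"
      have "norm (coef (lap (a s)) k) = (real_of_int k)\<^sup>2 * \<omega>\<^sup>2 * norm (coef (a s) k)"
        by (simp only: cl[OF s] norm_mult norm_of_real) (simp add: abs_mult)
      also have "\<dots> \<le> (real_of_int k)\<^sup>2 * \<omega>\<^sup>2 * (D * exp (- (\<kappa> * \<bar>k\<bar>)))"
        using s by (intro mult_left_mono \<kappa>(2)) auto
      finally show "norm (coef (lap (a s)) k) \<le> D * \<omega>\<^sup>2 * ((real_of_int k)\<^sup>2 * exp (- (\<kappa> * \<bar>k\<bar>)))"
        by (simp only: mult_ac)
    qed
  qed
  then have "isCont (\<lambda>t. lap (a t)) t" if t: "t \<in> {0<..<h}" for t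
  proof -
    have "t / 2 \<in> {0<..<h}" "t \<in> {t / 2<..<h}" using t by auto
    with \<open>\<And>t. t \<in> {0<..<h} \<Longrightarrow> continuous_on {t<..<h} (\<lambda>t. lap (a t))\<close> show ?thesis
      by (meson continuous_on_eq_continuous_at open_greaterThanLessThan)
  qed
  then show "continuous_on {0<..<h} (\<lambda>t. lap (a t))"
    by (simp add: continuous_at_imp_continuous_on)
qed

section \<open>Fourier series\<close>

abbreviation wave :: "int \<Rightarrow> real \<Rightarrow> complex"
  where "wave k x \<equiv> cis (real_of_int k * \<omega> * x)"

lemma has_vector_derivative_cis:
  "((\<lambda>x. cis (c * x)) has_vector_derivative \<i> * of_real c * cis (c * x)) (at x within S)"
proof -
  have "((\<lambda>z. exp (\<i> * of_real c * z)) has_field_derivative \<i> * of_real c * exp (\<i> * of_real c * of_real x))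
      (at (of_real x))"
    by (auto intro!: derivative_eq_intros)
  from has_vector_derivative_real_field[OF this, of S] show ?thesis
    by (simp add: cis_conv_exp mult.assoc)
qed

lemma cis_int_omega: "cis (real_of_int k * \<omega>) = 1"
  using cis_multiple_2pi[OF Ints_of_int, of k] by (simp only: mult.commute)

definition total :: "ell1 \<Rightarrow> complex"
  where "total a = (\<Sum>\<^sub>\<infinity>k. coef a k)"

lemma bounded_linear_total: "bounded_linear total"
proof (rule bounded_linear_intro[where K = 1])
  note summ = abs_summable_summable[OF coef[simplified]]
  show "total (a + b) = total a + total b" for a b
    by (simp add: total_def infsum_add[OF summ summ])
  show "total (r *\<^sub>R a) = r *\<^sub>R total a" for r a
    by (simp add: total_def infsum_scaleR_right)
  show "norm (total a) \<le> norm a * 1" for a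
    using norm_infsum_bound[OF coef_abs_summable[of a]] by (simp add: total_def norm_ell1_def)
qed

lemma total_cscale: "total (z *\<^sub>C a) = z * total a"
  by (simp add: total_def infsum_cmult_right')

lemma total_mode: "total (mode k z) = z"
proof -
  have "total (mode k z) = (\<Sum>\<^sub>\<infinity>j\<in>{k}. z)"
    unfolding total_def by (rule infsum_cong_neutral) auto
  then show ?thesis by simp
qed

lemma total_conv: "total (a \<star> b) = total a * total b"
proof -
  have "total (a \<star> b) = (\<Sum>\<^sub>\<infinity>(k, m). coef a (k - m) * coef b m)"
    using infsum_Sigma'_banach[of "\<lambda>k m. coef a (k - m) * coef b m" UNIV "\<lambda>_. UNIV"]
      abs_summable_summable[OF conv_array(1)[of a b]]
    by (simp add: total_def coef_conv)
  then show ?thesis by (simp add: conv_array(3) total_def)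
qed

text \<open>Translation by \<open>x\<close>, on the side of the coefficients. It turns statements about the dependence
  of a Fourier series on \<open>x\<close> into statements about curves in the space of sequences.\<close>

definition translate :: "real \<Rightarrow> ell1 \<Rightarrow> ell1"
  where "translate x a = Abs_ell1 (\<lambda>k. wave k x * coef a k)"

lemma coef_translate: "coef (translate x a) k = wave k x * coef a k"
  using coef_abs_summable[of a] by (simp add: translate_def coef_Abs_ell1 norm_mult)

lemma fourier_series_eq_total: "fourier_series a x = total (translate x a)"
  by (simp add: fourier_series_def total_def coef_translate mult.commute)

lemma norm_translate: "norm (translate x a) = norm a"
  by (simp add: norm_ell1_def coef_translate norm_mult)

lemma bounded_linear_fourier_series: "bounded_linear (\<lambda>a. fourier_series a x)"
  unfolding fourier_series_eq_total
  by (rule bounded_linear_compose[OF bounded_linear_total], rule bounded_linear_intro[where K = 1])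
    (auto intro!: ell1_eqI simp: coef_translate algebra_simps norm_translate)

lemma fourier_series_add: "fourier_series (a + b) x = fourier_series a x + fourier_series b x"
  by (rule linear_add[OF bounded_linear.linear[OF bounded_linear_fourier_series]])

lemma fourier_series_diff: "fourier_series (a - b) x = fourier_series a x - fourier_series b x"
  by (rule linear_diff[OF bounded_linear.linear[OF bounded_linear_fourier_series]])

lemma norm_fourier_series_le: "norm (fourier_series a x) \<le> norm a"
proof -
  have "norm (total b) \<le> norm b" for b
    using norm_infsum_bound[OF coef_abs_summable[of b]] by (simp add: total_def norm_ell1_def)
  from this[of "translate x a"] show ?thesis by (simp add: fourier_series_eq_total norm_translate)
qed

lemma fourier_series_cscale: "fourier_series (z *\<^sub>C a) x = z * fourier_series a x"
proof -
  have "translate x (z *\<^sub>C a) = z *\<^sub>C translate x a" by (rule ell1_eqI) (simp add: coef_translate)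
  then show ?thesis by (simp add: fourier_series_eq_total total_cscale)
qed

text \<open>Translation is multiplicative for convolution because \<open>k \<mapsto> e\<^bsup>ik\<omega>x\<^esup>\<close> is a character, and the
  total of a convolution is the product of the totals.\<close>

lemma fourier_series_conv: "fourier_series (a \<star> b) x = fourier_series a x * fourier_series b x"
proof -
  have "translate x (a \<star> b) = translate x a \<star> translate x b"
  proof (rule ell1_eqI)
    fix k
    have "wave k x * (coef a (k - m) * coef b m) =
        (wave (k - m) x * coef a (k - m)) * (wave m x * coef b m)" for m
    proof -
      have "wave k x = wave (k - m) x * wave m x" by (simp add: cis_mult algebra_simps)
      then show ?thesis by (simp only: mult_ac)
    qed
    then show "coef (translate x (a \<star> b)) k = coef (translate x a \<star> translate x b) k"
      by (simp only: coef_translate coef_conv infsum_cmult_right'[symmetric])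
  qed
  then show ?thesis by (simp add: fourier_series_eq_total total_conv)
qed

lemma fourier_series_periodic: "fourier_series a 1 = fourier_series a 0"
proof -
  have "wave k 1 = 1" for k by (simp add: cis_int_omega)
  then show ?thesis by (simp add: fourier_series_def)
qed

lemma continuous_on_translate: "continuous_on S (\<lambda>x. translate x a)"
  by (rule continuous_on_dominated[OF _ coef_abs_summable[of a]])
    (auto simp: coef_translate norm_mult intro!: continuous_intros)

text \<open>\<open>A s\<close> is replaced by \<open>A t\<close> at the cost of \<open>\<parallel>A s - A t\<parallel>\<close> uniformly in \<open>x\<close>, which separates the two
  variables.\<close>

lemma continuous_on_fourier_series:
  fixes A :: "'a::metric_space \<Rightarrow> ell1"
  assumes "continuous_on T A"
  shows "continuous_on (T \<times> S) (\<lambda>(t, x). fourier_series (A t) x)"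
  unfolding continuous_on_def
proof (clarsimp)
  fix t x assume t: "t \<in> T" "x \<in> S"
  let ?F = "at (t, x) within T \<times> S"
  have "continuous_on (T \<times> S) (\<lambda>p. A (fst p))"
    by (rule continuous_on_compose2[OF assms]) (auto intro!: continuous_intros)
  then have "((\<lambda>p. A (fst p)) \<longlongrightarrow> A t) ?F"
    using t by (fastforce simp: continuous_on_def)
  then have "((\<lambda>p. norm (A (fst p) - A t)) \<longlongrightarrow> 0) ?F"
    by (intro tendsto_norm_zero) (simp add: LIM_zero_iff)
  then have 1: "((\<lambda>p. fourier_series (A (fst p) - A t) (snd p)) \<longlongrightarrow> 0) ?F"
    by (rule Lim_null_comparison[rotated]) (simp add: norm_fourier_series_le)
  have "continuous_on UNIV (\<lambda>p :: 'a \<times> real. translate (snd p) (A t))"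
    by (rule continuous_on_compose2[OF continuous_on_translate[of UNIV]]) (auto intro!: continuous_intros)
  then have "continuous_on UNIV (\<lambda>p :: 'a \<times> real. fourier_series (A t) (snd p))"
    unfolding fourier_series_eq_total by (rule bounded_linear.continuous_on[OF bounded_linear_total])
  then have "((\<lambda>p. fourier_series (A t) (snd p)) \<longlongrightarrow> fourier_series (A t) x) ?F"
    by (fastforce simp: continuous_on_def intro: tendsto_within_subset[of _ _ _ UNIV])
  from tendsto_add[OF 1 this]
  show "((\<lambda>(t, x). fourier_series (A t) x) \<longlongrightarrow> fourier_series (A t) x) ?F"
    by (simp add: fourier_series_diff case_prod_unfold)
qed

text \<open>The coefficients of the spatial derivative. As with the Laplacian, the definition is only
  meaningful where the right-hand side is summable.\<close>

definition seq_deriv :: "ell1 \<Rightarrow> ell1"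
  where "seq_deriv a = Abs_ell1 (\<lambda>k. \<i> * of_real (real_of_int k * \<omega>) * coef a k)"

lemma coef_seq_deriv:
  assumes "a \<in> dom_lap"
  shows "coef (seq_deriv a) k = \<i> * of_real (real_of_int k * \<omega>) * coef a k"
proof -
  have "(\<lambda>k. \<omega> * ((real_of_int k)\<^sup>2 * norm (coef a k))) summable_on UNIV"
    using assms unfolding dom_lap_def by (intro summable_on_cmult_right) simp
  moreover have "norm (\<i> * of_real (real_of_int k * \<omega>) * coef a k) \<le> \<omega> * ((real_of_int k)\<^sup>2 * norm (coef a k))" for k
  proof -
    have "\<bar>k\<bar> \<le> k\<^sup>2"
      using self_le_power[of "\<bar>k\<bar>" 2] by (cases "k = 0") auto
    then have "real_of_int \<bar>k\<bar> \<le> real_of_int (k\<^sup>2)" by (simp only: of_int_le_iff)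
    then have "\<bar>real_of_int k\<bar> * (\<omega> * norm (coef a k)) \<le> (real_of_int k)\<^sup>2 * (\<omega> * norm (coef a k))"
      by (intro mult_right_mono) auto
    then show ?thesis by (simp add: norm_mult mult_ac)
  qed
  ultimately have "(\<lambda>k. \<i> * of_real (real_of_int k * \<omega>) * coef a k) abs_summable_on UNIV"
    by (rule Infinite_Sum.abs_summable_on_comparison_test')
  then show ?thesis by (simp add: seq_deriv_def coef_Abs_ell1)
qed

lemma has_vector_derivative_fourier_series:
  assumes "\<And>k. coef b k = \<i> * of_real (real_of_int k * \<omega>) * coef a k"
  shows "(fourier_series a has_vector_derivative fourier_series b x) (at x within S)"
proof -
  have "((\<lambda>x. translate x a) has_vector_derivative translate x b) (at x)"
  proof (rule has_vector_derivative_ell1I[of "x - 1" "x + 1" _ "\<lambda>x. translate x b"])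
    fix s k
    show "((\<lambda>r. coef (translate r a) k) has_vector_derivative coef (translate s b) k) (at s)"
      unfolding coef_translate assms
      by (rule has_vector_derivative_eq_rhs[OF has_vector_derivative_mult_left[OF has_vector_derivative_cis]])
        (simp add: mult_ac)
  qed (auto intro: continuous_on_translate)
  from bounded_linear.has_vector_derivative[OF bounded_linear_total this]
  have "(fourier_series a has_vector_derivative fourier_series b x) (at x)"
    by (simp add: fourier_series_eq_total[abs_def])
  then show ?thesis by (rule has_vector_derivative_at_within)
qed

text \<open>The coefficients of a Fourier series are recovered by integrating an explicit antiderivative
  of the series \<open>\<Sum>\<^sub>j b\<^sub>j e\<^bsup>i(j-k)\<omega>x\<^esup>\<close>.\<close>

lemma has_integral_fourier_coefficient:
  "((\<lambda>x. fourier_series b x * cis (- (real_of_int k * \<omega> * x))) has_integral coef b k) {0..1}"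
proof -
  \<comment> \<open>Off the mode \<open>j = k\<close> the antiderivative has period \<open>1\<close>, so only that mode contributes. The open
    interval \<open>(-1, 2)\<close> is a neighbourhood of \<open>[0, 1]\<close> on which the coefficients have a common majorant.\<close>
  define q where "q j x = (if j = k then of_real x else
    cis (real_of_int (j - k) * \<omega> * x) / (\<i> * of_real (real_of_int (j - k) * \<omega>)))" for j x
  have q_le: "norm (q j x * coef b j) \<le> 2 * norm (coef b j)" if "x \<in> {-1<..<2}" for j x
  proof -
    have "norm (q j x) \<le> 2"
    proof (cases "j = k")
      case False
      then have "1 \<le> \<bar>real_of_int (j - k)\<bar>" by linarith
      then have "1 * 1 \<le> \<bar>real_of_int (j - k)\<bar> * \<omega>"
        using pi_gt3 by (intro mult_mono) auto
      with False show ?thesis by (simp add: q_def norm_divide norm_mult divide_simps del: of_int_diff)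
    qed (use that in \<open>auto simp: q_def\<close>)
    then show ?thesis unfolding norm_mult by (intro mult_right_mono) auto
  qed
  define Q where "Q x = Abs_ell1 (\<lambda>j. q j x * coef b j)" for x
  have Q: "coef (Q x) j = q j x * coef b j" if "x \<in> {-1<..<2}" for x j
  proof -
    have "(\<lambda>j. q j x * coef b j) abs_summable_on UNIV"
      by (rule Infinite_Sum.abs_summable_on_comparison_test'[OF summable_on_cmult_right[OF coef_abs_summable[of b], of 2] q_le[OF that]])
    then show ?thesis by (simp add: Q_def coef_Abs_ell1)
  qed
  define D where "D x = cis (- (real_of_int k * \<omega> * x)) *\<^sub>C translate x b" for x
  have D: "coef (D x) j = cis (real_of_int (j - k) * \<omega> * x) * coef b j" for x j
    unfolding D_def coef_cscale coef_translate mult.assoc[symmetric] cis_mult by (simp add: algebra_simps)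
  have "((\<lambda>x. total (Q x)) has_vector_derivative total (D x)) (at x within {0..1})" if x: "x \<in> {0..1}" for x
  proof -
    have "(Q has_vector_derivative D x) (at x)"
    proof (rule has_vector_derivative_ell1I[of "-1" 2])
      fix s j assume s: "s \<in> {-1<..<2::real}"
      have q': "(q j has_vector_derivative cis (real_of_int (j - k) * \<omega> * s)) (at s)"
      proof (cases "j = k")
        case True
        have "((\<lambda>x. complex_of_real x) has_vector_derivative 1) (at s)"
          using bounded_linear.has_vector_derivative[OF bounded_linear_of_real has_vector_derivative_id[of "at s"]]
          by simp
        then show ?thesis using True by (simp add: q_def[abs_def])
      next
        case False
        have "((\<lambda>x. cis (real_of_int (j - k) * \<omega> * x) / (\<i> * of_real (real_of_int (j - k) * \<omega>)))
            has_vector_derivative \<i> * of_real (real_of_int (j - k) * \<omega>) * cis (real_of_int (j - k) * \<omega> * s)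
              / (\<i> * of_real (real_of_int (j - k) * \<omega>))) (at s)"
          by (intro has_vector_derivative_divide has_vector_derivative_cis)
        moreover have "\<i> * of_real (real_of_int (j - k) * \<omega>) \<noteq> 0" using False by simp
        ultimately show ?thesis using False by (simp add: q_def[abs_def])
      qed
      have "((\<lambda>x. q j x * coef b j) has_vector_derivative coef (D s) j) (at s)"
        unfolding D by (intro has_vector_derivative_mult_left q')
      then show "((\<lambda>r. coef (Q r) j) has_vector_derivative coef (D s) j) (at s)"
        by (rule has_vector_derivative_transform_within_open[where S = "{-1<..<2}"])
          (use s in \<open>auto simp: Q\<close>)
    next
      show "continuous_on {-1<..<2} D"
        by (rule continuous_on_dominated[OF _ coef_abs_summable[of b]])
          (auto simp: D norm_mult intro!: continuous_intros)
    qed (use x in auto)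
    from bounded_linear.has_vector_derivative[OF bounded_linear_total this] show ?thesis
      by (rule has_vector_derivative_at_within)
  qed
  then have "((\<lambda>x. total (D x)) has_integral total (Q 1) - total (Q 0)) {0..1}"
    by (intro fundamental_theorem_of_calculus) auto
  moreover have "Q 1 - Q 0 = mode k (coef b k)"
  proof (rule ell1_eqI)
    fix j
    show "coef (Q 1 - Q 0) j = coef (mode k (coef b k)) j"
      by (simp add: Q q_def cis_int_omega del: of_int_diff)
  qed
  then have "total (Q 1) - total (Q 0) = coef b k"
    by (metis total_mode linear_diff[OF bounded_linear.linear[OF bounded_linear_total]])
  moreover have "total (D x) = fourier_series b x * cis (- (real_of_int k * \<omega> * x))" for x
    by (simp add: D_def total_cscale fourier_series_eq_total mult.commute)
  ultimately show ?thesis by simp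
qed

section \<open>Solutions of the partial differential equation\<close>

text \<open>Exponential decay makes \<open>lap (a t)\<close> continuous in norm, hence \<open>a\<close> differentiable in norm with
  derivative \<open>e\<^bsup>i\<theta>\<^esup> (lap (a t) + a t \<star> a t)\<close>; each derivative of \<open>u\<close> is then the Fourier series of a
  curve of sequences that is continuous in norm.\<close>

lemma cauchy_solution_imp_pde:
  assumes \<theta>: "\<theta> \<in> {-pi/2<..<pi/2}"
    and a: "cauchy_solution \<theta> h \<phi> a" and R: "\<And>t. t \<in> {0..<h} \<Longrightarrow> norm (a t) \<le> R"
  shows "periodic_pde_solution \<theta> h \<phi> (\<lambda>t. fourier_series (a t))"
proof -
  have lap: "\<And>t. t \<in> {0<..<h} \<Longrightarrow> a t \<in> dom_lap" "continuous_on {0<..<h} (\<lambda>t. lap (a t))"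
    using cauchy_solution_lap[OF \<theta> a, of R] R by auto
  have cont: "continuous_on {0..<h} a" and a0: "a 0 = \<phi>"
    using a by (auto simp: cauchy_solution_def)
  have cont': "continuous_on {0<..<h} a" by (rule continuous_on_subset[OF cont]) auto
  define a' where "a' t = cis \<theta> *\<^sub>C (lap (a t) + a t \<star> a t)" for t
  have a'_cont: "continuous_on {0<..<h} a'"
    unfolding a'_def by (intro continuous_intros lap cont')
  have a': "(a has_vector_derivative a' t) (at t)" if t: "t \<in> {0<..<h}" for t
  proof (rule has_vector_derivative_ell1I[OF _ a'_cont t])
    fix s k assume s: "s \<in> {0<..<h}"
    have "coef (a' s) k = cis \<theta> * (- of_real ((real_of_int k)\<^sup>2 * \<omega>\<^sup>2) * coef (a s) k + coef (a s \<star> a s) k)"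
      by (simp add: a'_def coef_lap[OF lap(1)[OF s]])
    then show "((\<lambda>r. coef (a r) k) has_vector_derivative coef (a' s) k) (at s)"
      using a s unfolding cauchy_solution_def by metis
  qed
  have Dlap: "coef (lap (a t)) k = \<i> * of_real (real_of_int k * \<omega>) * coef (seq_deriv (a t)) k"
    if "t \<in> {0<..<h}" for t k
    using lap(1)[OF that] by (simp add: coef_lap coef_seq_deriv power2_eq_square algebra_simps)
  show ?thesis
    unfolding periodic_pde_solution_def
  proof (rule conjI[rotated], rule conjI, rule exI[of _ "\<lambda>t. fourier_series (a' t)"],
      rule exI[of _ "\<lambda>t. fourier_series (seq_deriv (a t))"],
      rule exI[of _ "\<lambda>t. fourier_series (lap (a t))"], intro conjI ballI)
    show "continuous_on ({0..<h} \<times> {0..1}) (\<lambda>(t, x). fourier_series (a t) x)"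
      by (rule continuous_on_fourier_series[OF cont])
    show "continuous_on ({0<..<h} \<times> {0..1}) (\<lambda>(t, x). fourier_series (a' t) x)"
      by (rule continuous_on_fourier_series[OF a'_cont])
    show "continuous_on ({0<..<h} \<times> {0..1}) (\<lambda>(t, x). fourier_series (lap (a t)) x)"
      by (rule continuous_on_fourier_series[OF lap(2)])
    show "\<forall>k. integral {0..1} (\<lambda>x. fourier_series (a 0) x * cis (- (real_of_int k * \<omega> * x))) = coef \<phi> k"
      unfolding a0 by (intro allI integral_unique[OF has_integral_fourier_coefficient])
    fix t assume t: "t \<in> {0<..<h}"
    show "fourier_series (a t) 0 = fourier_series (a t) 1"
      "fourier_series (seq_deriv (a t)) 0 = fourier_series (seq_deriv (a t)) 1"
      by (simp_all add: fourier_series_periodic)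
    fix x
    show "((\<lambda>s. fourier_series (a s) x) has_vector_derivative fourier_series (a' t) x) (at t)"
      by (rule bounded_linear.has_vector_derivative[OF bounded_linear_fourier_series a'[OF t]])
    show "(fourier_series (a t) has_vector_derivative fourier_series (seq_deriv (a t)) x) (at x within {0..1})"
      by (rule has_vector_derivative_fourier_series) (rule coef_seq_deriv[OF lap(1)[OF t]])
    show "(fourier_series (seq_deriv (a t)) has_vector_derivative fourier_series (lap (a t)) x) (at x within {0..1})"
      by (rule has_vector_derivative_fourier_series) (rule Dlap[OF t])
    show "fourier_series (a' t) x = cis \<theta> * (fourier_series (lap (a t)) x + (fourier_series (a t) x)\<^sup>2)"
      by (simp add: a'_def fourier_series_cscale fourier_series_add fourier_series_conv power2_eq_square)
  qed
qed

text \<open>Conversely, the coefficients of a classical solution are integrals against characters;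
  the time derivative passes under the integral and two integrations by parts, whose boundary terms
  cancel by periodicity, produce the factor \<open>-k\<^sup>2 \<omega>\<^sup>2\<close>.\<close>

lemma pde_imp_cauchy_solution:
  assumes pde: "periodic_pde_solution \<theta> h \<phi> (\<lambda>t. fourier_series (a t))"
    and cont: "continuous_on {0..<h} a" and a0: "a 0 = \<phi>"
  shows "cauchy_solution \<theta> h \<phi> a"
  unfolding cauchy_solution_def
proof (intro conjI ballI allI cont a0)
  fix t k assume t: "t \<in> {0<..<h}"
  obtain ut ux uxx where
    ut: "\<And>t x. t \<in> {0<..<h} \<Longrightarrow> x \<in> {0..1} \<Longrightarrow>
        ((\<lambda>s. fourier_series (a s) x) has_vector_derivative ut t x) (at t)"
    and ux: "\<And>t x. t \<in> {0<..<h} \<Longrightarrow> x \<in> {0..1} \<Longrightarrow>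
        (fourier_series (a t) has_vector_derivative ux t x) (at x within {0..1})"
    and uxx: "\<And>t x. t \<in> {0<..<h} \<Longrightarrow> x \<in> {0..1} \<Longrightarrow>
        (ux t has_vector_derivative uxx t x) (at x within {0..1})"
    and ut_cont: "continuous_on ({0<..<h} \<times> {0..1}) (\<lambda>(t, x). ut t x)"
    and eq: "\<And>t x. t \<in> {0<..<h} \<Longrightarrow> x \<in> {0<..<1} \<Longrightarrow>
        ut t x = cis \<theta> * (uxx t x + (fourier_series (a t) x)\<^sup>2)"
    and per: "\<And>t. t \<in> {0<..<h} \<Longrightarrow> fourier_series (a t) 0 = fourier_series (a t) 1 \<and> ux t 0 = ux t 1"
    using pde unfolding periodic_pde_solution_def by blast
  define \<eta> where "\<eta> x = cis (- (real_of_int k * \<omega>) * x)" for x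
  have \<eta>_cont: "continuous_on S \<eta>" for S unfolding \<eta>_def by (intro continuous_intros)
  \<comment> \<open>\<open>c\<close> is the factor that differentiation of the \<open>k\<close>-th mode produces, and \<open>c\<^sup>2 = -k\<^sup>2 \<omega>\<^sup>2\<close>.\<close>
  define c where "c = \<i> * of_real (real_of_int k * \<omega>)"
  have \<eta>': "(\<eta> has_vector_derivative - c * \<eta> x) (at x within S)" for x S
    using has_vector_derivative_cis[of "- (real_of_int k * \<omega>)" x S] by (simp add: \<eta>_def[abs_def] c_def)
  have \<eta>01: "\<eta> 0 = 1" "\<eta> 1 = 1"
    using cis_int_omega[of "- k"] by (simp_all add: \<eta>_def)
  have coef_int: "((\<lambda>x. fourier_series b x * \<eta> x) has_integral coef b k) {0..1}" for b
    using has_integral_fourier_coefficient[of b k] by (simp add: \<eta>_def)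
  have "((\<lambda>s. integral (cbox 0 1) (\<lambda>x. fourier_series (a s) x * \<eta> x)) has_vector_derivative
      integral (cbox 0 1) (\<lambda>x. ut t x * \<eta> x)) (at t within {0<..<h})"
  proof (rule leibniz_rule_vector_derivative)
    show "((\<lambda>s. fourier_series (a s) x * \<eta> x) has_vector_derivative ut s x * \<eta> x) (at s within {0<..<h})"
      if "s \<in> {0<..<h}" "x \<in> cbox 0 1" for s x
      by (rule has_vector_derivative_at_within, rule has_vector_derivative_mult_left, rule ut)
        (use that in auto)
    show "(\<lambda>x. fourier_series (a s) x * \<eta> x) integrable_on cbox 0 1" for s
      using has_integral_integrable[OF coef_int[of "a s"]] by simp
    have "continuous_on ({0<..<h} \<times> {0..1}) (\<lambda>p. (case p of (s, x) \<Rightarrow> ut s x) * \<eta> (snd p))"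
      by (intro continuous_intros ut_cont continuous_on_compose2[OF \<eta>_cont]) auto
    then show "continuous_on ({0<..<h} \<times> cbox 0 1) (\<lambda>(s, x). ut s x * \<eta> x)"
      by (simp add: case_prod_unfold)
  qed (use t in auto)
  then have der: "((\<lambda>s. coef (a s) k) has_vector_derivative integral {0..1} (\<lambda>x. ut t x * \<eta> x)) (at t)"
    using t integral_unique[OF coef_int] at_within_open[of t "{0<..<h}"] by simp
  have "((\<lambda>x. uxx t x * \<eta> x - c\<^sup>2 * (fourier_series (a t) x * \<eta> x)) has_integral
      (ux t 1 * \<eta> 1 + c * (fourier_series (a t) 1 * \<eta> 1)) - (ux t 0 * \<eta> 0 + c * (fourier_series (a t) 0 * \<eta> 0))) {0..1}"
  proof (rule fundamental_theorem_of_calculus)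
    fix x :: real assume x: "x \<in> {0..1}"
    have "((\<lambda>x. ux t x * \<eta> x + c * (fourier_series (a t) x * \<eta> x)) has_vector_derivative
        (ux t x * (- c * \<eta> x) + uxx t x * \<eta> x)
        + c * (fourier_series (a t) x * (- c * \<eta> x) + ux t x * \<eta> x)) (at x within {0..1})"
      using t x by (intro has_vector_derivative_add has_vector_derivative_mult_right
          has_vector_derivative_mult ux uxx \<eta>') auto
    then show "((\<lambda>x. ux t x * \<eta> x + c * (fourier_series (a t) x * \<eta> x)) has_vector_derivative
        uxx t x * \<eta> x - c\<^sup>2 * (fourier_series (a t) x * \<eta> x)) (at x within {0..1})"
      by (simp add: algebra_simps power2_eq_square)
  qed simp
  then have "((\<lambda>x. uxx t x * \<eta> x - c\<^sup>2 * (fourier_series (a t) x * \<eta> x)) has_integral 0) {0..1}"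
    using per[OF t] by (simp add: \<eta>01)
  from has_integral_add[OF has_integral_add[OF this has_integral_mult_right[OF coef_int[of "a t"], of "c\<^sup>2"]]
      coef_int[of "a t \<star> a t"]]
  have "((\<lambda>x. uxx t x * \<eta> x + fourier_series (a t \<star> a t) x * \<eta> x) has_integral
      c\<^sup>2 * coef (a t) k + coef (a t \<star> a t) k) {0..1}" by simp
  \<comment> \<open>The differential equation is only required at interior points of \<open>[0,1]\<close>.\<close>
  from has_integral_mult_right[OF this, of "cis \<theta>"]
  have "((\<lambda>x. ut t x * \<eta> x) has_integral cis \<theta> * (c\<^sup>2 * coef (a t) k + coef (a t \<star> a t) k)) {0..1}"
  proof (rule has_integral_spike_finite[rotated 2])
    show "finite {0, 1::real}" by simp
    show "ut t x * \<eta> x = cis \<theta> * (uxx t x * \<eta> x + fourier_series (a t \<star> a t) x * \<eta> x)"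
      if "x \<in> {0..1} - {0, 1}" for x
      using eq[OF t, of x] that by (auto simp: fourier_series_conv power2_eq_square algebra_simps)
  qed
  with der have "((\<lambda>s. coef (a s) k) has_vector_derivative
      cis \<theta> * (c\<^sup>2 * coef (a t) k + coef (a t \<star> a t) k)) (at t)"
    by (simp add: integral_unique)
  moreover have "c\<^sup>2 = - of_real ((real_of_int k)\<^sup>2 * \<omega>\<^sup>2)"
    by (simp add: c_def power_mult_distrib)
  ultimately show "((\<lambda>s. coef (a s) k) has_vector_derivative
      cis \<theta> * (- of_real ((real_of_int k)\<^sup>2 * \<omega>\<^sup>2) * coef (a t) k + coef (a t \<star> a t) k)) (at t)"
    by simp
qed

theorem theorem4p1:
  fixes \<theta> h \<epsilon> \<rho> \<delta> W :: real and N :: nat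
    and \<phi> :: ell1 and abar :: "real \<Rightarrow> ell1"
    and U :: "real \<Rightarrow> real \<Rightarrow> ell1 \<Rightarrow>\<^sub>L ell1"
  assumes "\<theta> \<in> {-pi/2<..<pi/2}" and "h > 0"
    and "\<And>t k. t \<in> {0..<h} \<Longrightarrow> \<bar>k\<bar> > int N \<Longrightarrow> coef (abar t) k = 0"
    and "abar \<in> space_X h" and "continuous_on {0..<h} abar"
    and "abar \<in> C1_dom_lap h"
    and "evolution_operator \<theta> h abar U"
    and "\<epsilon> \<ge> 0" and "norm (\<phi> - abar 0) \<le> \<epsilon>"
    and "\<rho> > 0"
    and "W > 0"
    and "(SUP (s, t)\<in>{(s, t). 0 \<le> s \<and> s \<le> t \<and> t \<le> h}. ennreal (norm (U t s))) \<le> ennreal W"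
    and "\<delta> > 0" and "sup_norm h (F_op \<theta> abar) \<le> ennreal \<delta>"
    and "\<And>a. a \<in> ball_J h \<phi> abar \<rho> \<Longrightarrow>
      (SUP t\<in>{0<..<h}. ennreal (\<Sum>\<^sub>\<infinity>k. norm (coef (T_op \<theta> \<phi> abar U a t - abar t) k)))
        \<le> ennreal (f_bound W h \<delta> \<epsilon> \<rho>)"
    and "f_bound W h \<delta> \<epsilon> \<rho> \<le> \<rho>"
  shows "\<exists>atilde \<in> ball_J h \<phi> abar \<rho>.
    cauchy_solution \<theta> h \<phi> atilde \<and>
    periodic_pde_solution \<theta> h \<phi> (\<lambda>t. fourier_series (atilde t)) \<and>
    (\<forall>a \<in> ball_J h \<phi> abar \<rho>.
       cauchy_solution \<theta> h \<phi> a \<or> periodic_pde_solution \<theta> h \<phi> (\<lambda>t. fourier_series (a t))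
       \<longrightarrow> (\<forall>t\<in>{0..<h}. a t = atilde t))"
proof -
  note \<theta> = assms(1) and h = assms(2) and U = assms(7)
  define C where "C = enn2real (sup_norm h abar) + norm (abar 0) + 1"
  have C: "C > 0" "norm (abar t) \<le> C" if "t \<in> {0..<h}" for t
  proof -
    show "C > 0" by (simp add: C_def add_nonneg_pos)
    show "norm (abar t) \<le> C"
    proof (cases "t = 0")
      case False
      then have "ennreal (norm (abar t)) \<le> sup_norm h abar"
        using that unfolding sup_norm_def by (intro SUP_upper) auto
      moreover have "sup_norm h abar < top" using assms(4) by (simp add: space_X_def)
      ultimately have "enn2real (ennreal (norm (abar t))) \<le> enn2real (sup_norm h abar)"
        by (intro enn2real_mono)
      then show ?thesis by (simp add: C_def add_increasing2)
    qed (simp add: C_def)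
  qed
  have "C > 0" using C(1)[of 0] h by simp
  have W: "norm (U t s) \<le> W" if "0 \<le> s" "s \<le> t" "t \<le> h" for s t
  proof -
    have "ennreal (norm (U t s)) \<le>
        (SUP (s, t)\<in>{(s, t). 0 \<le> s \<and> s \<le> t \<and> t \<le> h}. ennreal (norm (U t s)))"
      using that by (intro SUP_upper2[of "(s, t)"]) auto
    from order_trans[OF this assms(12)] show ?thesis using assms(11) by simp
  qed
  have abar: "diag_solution (heat \<theta>) 0 h (\<lambda>r. cis \<theta> *\<^sub>C (abar r \<star> abar r) + F_op \<theta> abar r) abar"
    unfolding diag_solution_def
  proof (intro conjI ballI allI assms(5))
    fix t k assume t: "t \<in> {0<..<h}"
    obtain a' where a': "abar t \<in> dom_lap" "(abar has_vector_derivative a') (at t)"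
      using assms(6) t unfolding C1_dom_lap_def by blast
    then have "F_op \<theta> abar t = a' - cis \<theta> *\<^sub>C (lap (abar t) + abar t \<star> abar t)"
      by (simp add: F_op_def vector_derivative_at)
    then have "coef (F_op \<theta> abar t) k = coef a' k - cis \<theta> * (coef (lap (abar t)) k + coef (abar t \<star> abar t) k)"
      by simp
    then have "coef a' k = - heat \<theta> k * coef (abar t) k
        + coef (cis \<theta> *\<^sub>C (abar t \<star> abar t) + F_op \<theta> abar t) k"
      by (simp add: coef_lap[OF a'(1)] heat_def algebra_simps)
    with bounded_linear.has_vector_derivative[OF bounded_linear_coef a'(2), of k]
    show "((\<lambda>r. coef (abar r) k) has_vector_derivative - heat \<theta> k * coef (abar t) k
        + coef (cis \<theta> *\<^sub>C (abar t \<star> abar t) + F_op \<theta> abar t) k) (at t)" by simp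
  qed
  have F: "norm (F_op \<theta> abar t) \<le> \<delta>" if "t \<in> {0<..<h}" for t
  proof -
    have "ennreal (norm (F_op \<theta> abar t)) \<le> sup_norm h (F_op \<theta> abar)"
      unfolding sup_norm_def by (rule SUP_upper[OF that])
    from order_trans[OF this assms(14)] show ?thesis using assms(13) by simp
  qed
  have "W * (\<epsilon> + h * (\<rho>\<^sup>2 + \<delta>)) \<le> f_bound W h \<delta> \<epsilon> \<rho>"
    unfolding f_bound_def using assms(11) h by (intro mult_left_mono add_left_mono) auto
  with assms(16) have small: "W * (\<epsilon> + h * (\<rho>\<^sup>2 + \<delta>)) \<le> \<rho>" by linarith
  obtain a where a: "cauchy_solution \<theta> h \<phi> a"
    and a_le: "\<And>t. t \<in> {0..<h} \<Longrightarrow> norm (a t - abar t) \<le> \<rho>"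
    using cauchy_solution_enclosure[OF \<theta> h U \<open>C > 0\<close> C(2) W abar F assms(9,10) small] by blast
  have bound: "norm (b t) \<le> C + \<rho>" if "t \<in> {0..<h}" "norm (b t - abar t) \<le> \<rho>" for b :: "real \<Rightarrow> ell1" and t
    using norm_triangle_sub[of "b t" "abar t"] C(2)[OF that(1)] that(2) by linarith
  have a_bound: "norm (a t) \<le> C + \<rho>" if "t \<in> {0..<h}" for t
    using bound that a_le by blast
  have "a \<in> ball_J h \<phi> abar \<rho>"
  proof -
    have cont: "continuous_on {0..<h} a" "a 0 = \<phi>" using a by (auto simp: cauchy_solution_def)
    have "sup_norm h a \<le> ennreal (C + \<rho>)"
      unfolding sup_norm_def using a_bound by (intro SUP_least ennreal_leI) auto
    then have "sup_norm h a < \<infinity>" by (simp add: le_less_trans)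
    moreover have "sup_norm h (\<lambda>t. a t - abar t) \<le> ennreal \<rho>"
      unfolding sup_norm_def using a_le by (intro SUP_least ennreal_leI) auto
    moreover have "continuous_on {0<..<h} a" by (rule continuous_on_subset[OF cont(1)]) auto
    ultimately show ?thesis using cont by (simp add: ball_J_def space_X_def)
  qed
  moreover have "periodic_pde_solution \<theta> h \<phi> (\<lambda>t. fourier_series (a t))"
    by (rule cauchy_solution_imp_pde[OF \<theta> a a_bound])
  moreover have "b t = a t"
    if b: "b \<in> ball_J h \<phi> abar \<rho>"
      "cauchy_solution \<theta> h \<phi> b \<or> periodic_pde_solution \<theta> h \<phi> (\<lambda>t. fourier_series (b t))"
      and t: "t \<in> {0..<h}" for b t
  proof (rule cauchy_solution_unique[OF \<theta> _ _ a _ t])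
    show "cauchy_solution \<theta> h \<phi> b"
      using b pde_imp_cauchy_solution[of \<theta> h \<phi> b] by (auto simp: ball_J_def)
    fix r assume r: "r \<in> {0<..<h}"
    show "norm (a r) \<le> C + \<rho>" using a_bound r by simp
    have "ennreal (norm (b r - abar r)) \<le> sup_norm h (\<lambda>t. b t - abar t)"
      unfolding sup_norm_def by (rule SUP_upper[OF r])
    also have "\<dots> \<le> ennreal \<rho>" using b(1) by (simp add: ball_J_def)
    finally have "norm (b r - abar r) \<le> \<rho>" using assms(10) by simp
    then show "norm (b r) \<le> C + \<rho>" using bound r by simp
  qed
  ultimately show ?thesis using a by blast
qed

end
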